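(* Let $K=K(n)$ be positive integers with $K\to\infty$ and $n/K\to\infty$ as $n\to\infty$, and assume that the initial law $\mu_K$ of the walk $Y_K$ is the uniform distribution on $V_K$. Let $s\ge 1$ and, for each $n$, let $\mathbf{t}_n=(t_1(n),\dots,t_s(n))\in(\mathbb{R}_+)^s$ be such that \[\frac{n}{K}\left(t_{j+1}(n)-t_j(n)\right)\underset{n\to\infty}{\longrightarrow}+\infty \quad\text{for all } 1\leq j\leq s-1 .\] Then, as $n\to\infty$, \[\frac{1}{\sqrt{K}}\left(X_{n,K}(t_1(n)),\dots,X_{n,K}(t_s(n))\right)\overset{\mathcal{D}}{\longrightarrow}\left(G_j\right)_{1\leq j\leq s},\] where $G_1,\dots,G_s$ are i.i.d. Gaussian random variables $\mathcal{N}(0,1)$.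
   Context: For $K\ge 1$, $V_K=\{-1,+1\}^K$ is the vertex set of the $K$-dimensional hypercube, in which two vertices are adjacent iff they differ in exactly one coordinate. $(Y_K(i))_{i\ge 0}$ is the simple random walk on this graph (at each step a uniformly chosen coordinate, independent of the past, changes sign), started from the law $\mu_K$ on $V_K$. $f_K(v)=\sum_{i=1}^K v^{(i)}$ for $v\in V_K$, and $X_{n,K}(t)=f_K(Y_K(\lfloor nt\rfloor))$ for $t\ge 0$. *)

theory Defs
  imports "HOL-Probability.Probability"
begin

definition hypercube :: "nat \<Rightarrow> (nat \<Rightarrow> real) set" where
  "hypercube K = {1..K} \<rightarrow>\<^sub>E {-1, 1}"

definition hypercube_adj :: "nat \<Rightarrow> (nat \<Rightarrow> real) \<Rightarrow> (nat \<Rightarrow> real) \<Rightarrow> bool" where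
  "hypercube_adj K v w \<longleftrightarrow>
     v \<in> hypercube K \<and> w \<in> hypercube K \<and> card {i \<in> {1..K}. v i \<noteq> w i} = 1"

definition srw_step :: "nat \<Rightarrow> (nat \<Rightarrow> real) \<Rightarrow> (nat \<Rightarrow> real) pmf" where
  "srw_step K v = pmf_of_set {w. hypercube_adj K v w}"

text \<open>The walk is given through its joint law: conditionally on the whole past, the next
  vertex has law \<^term>\<open>srw_step K v\<close>, where \<^term>\<open>v\<close> is the current vertex.  The Markov
  property is written in product form, so that no conditioning on null events occurs.\<close>

definition hypercube_srw ::
  "'a measure \<Rightarrow> nat \<Rightarrow> (nat \<Rightarrow> real) measure \<Rightarrow> (nat \<Rightarrow> 'a \<Rightarrow> nat \<Rightarrow> real) \<Rightarrow> bool" where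
  "hypercube_srw M K \<mu> Y \<longleftrightarrow>
     prob_space M \<and>
     (\<forall>i. Y i \<in> M \<rightarrow>\<^sub>M count_space (hypercube K)) \<and>
     distr M (count_space (hypercube K)) (Y 0) = \<mu> \<and>
     (\<forall>i. \<forall>p. (\<forall>j\<le>Suc i. p j \<in> hypercube K) \<longrightarrow>
        measure M {\<omega> \<in> space M. \<forall>j\<le>Suc i. Y j \<omega> = p j} =
        measure M {\<omega> \<in> space M. \<forall>j\<le>i. Y j \<omega> = p j} * pmf (srw_step K (p i)) (p (Suc i)))"

definition coord_sum :: "nat \<Rightarrow> (nat \<Rightarrow> real) \<Rightarrow> real" where
  "coord_sum K v = (\<Sum>i=1..K. v i)"

definition scaled_walk ::
  "(nat \<Rightarrow> nat \<Rightarrow> 'a \<Rightarrow> nat \<Rightarrow> real) \<Rightarrow> nat \<Rightarrow> nat \<Rightarrow> real \<Rightarrow> 'a \<Rightarrow> real" where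
  "scaled_walk Y n K t \<omega> = coord_sum K (Y K (nat \<lfloor>real n * t\<rfloor>) \<omega>)"

text \<open>Convergence in distribution of random vectors with values in the \<open>s\<close>-dimensional real
  space, represented by the extensional functions on \<^term>\<open>{1..s}\<close> with the product topology
  and the product sigma-algebra.  The vectors may live on different probability spaces.\<close>

definition conv_in_distribution ::
  "nat \<Rightarrow> (nat \<Rightarrow> 'a measure) \<Rightarrow> (nat \<Rightarrow> 'a \<Rightarrow> nat \<Rightarrow> real) \<Rightarrow>
   'b measure \<Rightarrow> ('b \<Rightarrow> nat \<Rightarrow> real) \<Rightarrow> bool" where
  "conv_in_distribution s M X N Z \<longleftrightarrow>
     (\<forall>n. X n \<in> M n \<rightarrow>\<^sub>M (\<Pi>\<^sub>M j\<in>{1..s}. borel)) \<and>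
     Z \<in> N \<rightarrow>\<^sub>M (\<Pi>\<^sub>M j\<in>{1..s}. borel) \<and>
     (\<forall>g. continuous_map (powertop_real {1..s}) euclideanreal g \<longrightarrow>
          bounded (g ` topspace (powertop_real {1..s})) \<longrightarrow>
          (\<lambda>n. \<integral>\<omega>. g (X n \<omega>) \<partial>M n) \<longlonglongrightarrow> (\<integral>\<omega>. g (Z \<omega>) \<partial>N))"

lemma flip_in_hypercube:
  assumes "v \<in> hypercube K" and "c \<in> {1..K}"
  shows "v(c := - v c) \<in> hypercube K"
  using assms by (auto simp: hypercube_def PiE_iff extensional_def)

lemma hypercube_adj_iff_flip:
  assumes v: "v \<in> hypercube K"
  shows "hypercube_adj K v w \<longleftrightarrow> (\<exists>c\<in>{1..K}. w = v(c := - v c))"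
proof
  assume adj: "hypercube_adj K v w"
  then obtain c where c: "{i \<in> {1..K}. v i \<noteq> w i} = {c}"
    unfolding hypercube_adj_def by (auto simp: card_1_singleton_iff)
  have w: "w \<in> hypercube K" using adj by (simp add: hypercube_adj_def)
  have cK: "c \<in> {1..K}" and ne: "v c \<noteq> w c" using c by blast+
  have "v c \<in> {-1, 1}" "w c \<in> {-1, 1}"
    using v w cK by (auto simp: hypercube_def PiE_iff)
  then have wc: "w c = - v c" using ne by auto
  have "w i = v i" if "i \<noteq> c" for i
  proof (cases "i \<in> {1..K}")
    case True
    have "i \<notin> {i \<in> {1..K}. v i \<noteq> w i}" unfolding c using that by simp
    then show ?thesis using True by simp
  next
    case False
    have "v i = undefined" "w i = undefined"
      using v[unfolded hypercube_def] w[unfolded hypercube_def] False by (auto dest: PiE_arb)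
    then show ?thesis by simp
  qed
  then have "w = v(c := - v c)" using wc by (simp add: fun_eq_iff)
  then show "\<exists>c\<in>{1..K}. w = v(c := - v c)" using cK by blast
next
  assume "\<exists>c\<in>{1..K}. w = v(c := - v c)"
  then obtain c where cK: "c \<in> {1..K}" and w: "w = v(c := - v c)" by blast
  have "v c \<in> {-1, 1}" using v cK by (auto simp: hypercube_def PiE_iff)
  then have "v i \<noteq> w i \<longleftrightarrow> i = c" for i using w by auto
  then have "{i \<in> {1..K}. v i \<noteq> w i} = {c}" using cK by auto
  then show "hypercube_adj K v w"
    using v flip_in_hypercube[OF v cK] w by (simp add: hypercube_adj_def)
qed

text \<open>Moving to a uniform neighbour means changing the sign of a uniformly chosen coordinate.\<close>

lemma srw_step_eq_flip:
  assumes v: "v \<in> hypercube K" and K: "K \<ge> 1"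
  shows "srw_step K v = map_pmf (\<lambda>c. v(c := - v c)) (pmf_of_set {1..K})"
proof -
  have nz: "v c \<noteq> 0" if "c \<in> {1..K}" for c
  proof -
    have "v c \<in> {-1, 1}" using v that unfolding hypercube_def by (rule PiE_mem)
    then show ?thesis by auto
  qed
  have inj: "inj_on (\<lambda>c. v(c := - v c)) {1..K}"
  proof (rule inj_onI)
    fix c d assume c: "c \<in> {1..K}" and "v(c := - v c) = v(d := - v d)"
    then have "(v(c := - v c)) c = (v(d := - v d)) c" by simp
    then show "c = d" using nz[OF c] by (cases "c = d") simp_all
  qed
  have "{w. hypercube_adj K v w} = (\<lambda>c. v(c := - v c)) ` {1..K}"
    using hypercube_adj_iff_flip[OF v] by auto
  then show ?thesis
    unfolding srw_step_def using K inj by (simp add: map_pmf_of_set_inj)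
qed

end

theory Submission
  imports Defs "HOL-Real_Asymp.Real_Asymp"
begin

text \<open>The Walsh function of \<open>S \<subseteq> {1..K}\<close> is an eigenfunction of the walk with eigenvalue
  \<open>1 - 2 |S| / K\<close>, and under the uniform law the Walsh functions are orthonormal.  Since the
  coordinates are \<open>\<plusminus>1\<close>, the character \<open>exp (i x f(v))\<close> is the product over the coordinates of
  \<open>cos x + i v\<^sub>c sin x\<close>, which expands explicitly into Walsh functions.  Hence, after \<open>m\<close> steps
  and conditionally on the past, it differs from the constant \<open>(cos x)\<^sup>K\<close> in mean square by
  at most \<open>(1 - 2 / K)\<^sup>2\<^sup>m + (sin x)\<^sup>2\<^sup>K\<close>; the second term comes from the eigenvalue \<open>-1\<close>, i.e. from
  the periodicity of the walk.  With \<open>x = \<theta> / \<surd>K\<close> and \<open>m / K \<rightarrow> \<infinity>\<close> the error vanishes and the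
  constants tend to \<open>exp (- \<theta>\<^sup>2 / 2)\<close>, so the joint characteristic functions converge to those of
  independent standard normal variables.  As second moments are bounded, this implies convergence
  in distribution by the Stone--Weierstrass theorem.\<close>

section \<open>Walsh functions on the hypercube\<close>

definition walsh :: "nat set \<Rightarrow> (nat \<Rightarrow> real) \<Rightarrow> real" where
  "walsh S v = (\<Prod>c\<in>S. v c)"

lemma walsh_empty [simp]: "walsh {} v = 1"
  by (simp add: walsh_def)

lemma walsh_flip:
  assumes "finite S"
  shows "walsh S (v(c := - v c)) = (if c \<in> S then - 1 else 1) * walsh S v"
proof (cases "c \<in> S")
  case True
  have "(\<Prod>d\<in>S - {c}. (v(c := - v c)) d) = (\<Prod>d\<in>S - {c}. v d)"
    by (intro prod.cong) auto
  then show ?thesis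
    using True assms by (simp add: walsh_def prod.remove[of S c])
next
  case False
  then show ?thesis
    by (auto simp: walsh_def intro!: prod.cong)
qed

lemma finite_hypercube [simp]: "finite (hypercube K)"
  by (auto simp: hypercube_def intro!: finite_PiE)

lemma hypercube_coord:
  assumes "v \<in> hypercube K" "c \<in> {1..K}"
  shows "v c = 1 \<or> v c = - 1"
  using assms by (auto simp: hypercube_def PiE_iff)

text \<open>Coordinates in \<open>S\<close> and \<open>T\<close> both occur squared, hence
  contribute 1, and only the symmetric difference survives.\<close>

lemma walsh_mult:
  assumes "v \<in> hypercube K" "S \<subseteq> {1..K}" "T \<subseteq> {1..K}"
  shows "walsh S v * walsh T v = walsh ((S - T) \<union> (T - S)) v"
proof -
  have fin: "finite S" "finite T" using assms finite_subset by blast+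
  have "(\<Prod>c\<in>S \<inter> T. v c) * (\<Prod>c\<in>S \<inter> T. v c) = (\<Prod>c\<in>S \<inter> T. v c * v c)"
    by (simp add: prod.distrib)
  also have "\<dots> = 1"
  proof (rule prod.neutral, rule ballI)
    fix c assume "c \<in> S \<inter> T"
    then have "c \<in> {1..K}" using assms(2) by blast
    from hypercube_coord[OF assms(1) this] show "v c * v c = 1" by auto
  qed
  finally have 1: "(\<Prod>c\<in>S \<inter> T. v c) * (\<Prod>c\<in>S \<inter> T. v c) = 1" .
  have "walsh S v = walsh (S - T) v * (\<Prod>c\<in>S \<inter> T. v c)"
    using fin prod.Int_Diff[of S v T] by (simp add: walsh_def mult.commute)
  moreover have "walsh T v = walsh (T - S) v * (\<Prod>c\<in>S \<inter> T. v c)"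
    using fin prod.Int_Diff[of T v S] by (simp add: walsh_def mult.commute Int_commute)
  moreover have "walsh ((S - T) \<union> (T - S)) v = walsh (S - T) v * walsh (T - S) v"
    unfolding walsh_def using fin by (intro prod.union_disjoint) auto
  ultimately show ?thesis using 1 by (simp add: algebra_simps)
qed

text \<open>Of the K equally likely flips, those at \<open>S\<close> negate the Walsh function and
  the other K - |S| preserve it; the average is the eigenvalue (K - 2|S|) / K.\<close>

lemma sum_srw_step_walsh:
  assumes v: "v \<in> hypercube K" and K: "K \<ge> 1" and S: "S \<subseteq> {1..K}"
  shows "(\<Sum>w\<in>hypercube K. pmf (srw_step K v) w * walsh S w)
    = (1 - 2 * real (card S) / real K) * walsh S v"
proof -
  have fin: "finite S" using S finite_subset by blast
  have supp: "set_pmf (srw_step K v) \<subseteq> hypercube K"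
    using flip_in_hypercube[OF v] K by (auto simp: srw_step_eq_flip[OF v K])
  have "(\<Sum>w\<in>hypercube K. pmf (srw_step K v) w * walsh S w)
    = measure_pmf.expectation (srw_step K v) (walsh S)"
    using supp by (subst integral_measure_pmf_real[of "hypercube K"]) (auto simp: mult.commute)
  also have "\<dots> = (\<Sum>c=1..K. walsh S (v(c := - v c))) / real K"
    using K by (simp add: srw_step_eq_flip[OF v K] integral_pmf_of_set)
  also have "(\<Sum>c=1..K. walsh S (v(c := - v c)))
    = (\<Sum>c=1..K. (1 - 2 * indicator S c) * walsh S v)"
    by (intro sum.cong) (auto simp: walsh_flip[OF fin])
  also have "\<dots> = (\<Sum>c=1..K. 1 - 2 * indicator S c) * walsh S v"
    by (rule sum_distrib_right[symmetric])
  also have "(\<Sum>c=1..K. 1 - 2 * indicator S c) = real K - 2 * real (card S)"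
    using S by (simp add: sum_subtractf sum_distrib_left[symmetric] indicator_def sum.If_cases
        Int_absorb1 del: One_nat_def)
  finally show ?thesis using K by (simp add: field_simps)
qed

text \<open>Flipping one coordinate of \<open>S\<close> is an involution of the cube that negates
  the summand, so the sum equals its own negative.\<close>

lemma sum_hypercube_walsh:
  assumes S: "S \<subseteq> {1..K}" "S \<noteq> {}"
  shows "(\<Sum>v\<in>hypercube K. walsh S v) = 0"
proof -
  obtain c where c: "c \<in> S" using S by blast
  have fin: "finite S" using S finite_subset by blast
  have cK: "c \<in> {1..K}" using c S by blast
  have "(\<Sum>v\<in>hypercube K. walsh S v) = (\<Sum>v\<in>hypercube K. walsh S (v(c := - v c)))"
    by (rule sum.reindex_bij_witness[of _ "\<lambda>v. v(c := - v c)" "\<lambda>v. v(c := - v c)"])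
      (use cK in \<open>auto simp: flip_in_hypercube\<close>)
  then show ?thesis using c by (simp add: walsh_flip[OF fin] sum_negf)
qed

text \<open>When the product of the factors cos x + i v_c sin x is expanded, \<open>S\<close>
  records the coordinates at which the sine term is chosen.\<close>

lemma iexp_coord_sum_eq_walsh_sum:
  assumes v: "v \<in> hypercube K"
  shows "iexp (x * coord_sum K v) =
    (\<Sum>S\<in>Pow {1..K}. (\<i> * sin x) ^ card S * cos x ^ (K - card S) * walsh S v)"
proof -
  have "iexp (x * coord_sum K v) = (\<Prod>c=1..K. iexp (x * v c))"
    by (simp add: coord_sum_def sum_distrib_left exp_sum)
  also have "\<dots> = (\<Prod>c=1..K. \<i> * sin x * v c + cos x)"
  proof (intro prod.cong refl)
    fix c assume "c \<in> {1..K}"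
    then show "iexp (x * v c) = \<i> * sin x * v c + cos x"
      using hypercube_coord[OF v, of c]
      by (auto simp: exp_Euler exp_minus_Euler sin_of_real cos_of_real algebra_simps)
  qed
  also have "\<dots> = (\<Sum>S\<in>Pow {1..K}. (\<Prod>c\<in>S. \<i> * sin x * v c) * (\<Prod>c\<in>{1..K} - S. complex_of_real (cos x)))"
    by (rule prod_add) simp
  also have "\<dots> = (\<Sum>S\<in>Pow {1..K}. (\<i> * sin x) ^ card S * cos x ^ (K - card S) * walsh S v)"
    by (intro sum.cong refl)
      (auto simp: prod.distrib walsh_def card_Diff_subset finite_subset power_mult_distrib)
  finally show ?thesis .
qed

section \<open>The walk started from the uniform law\<close>

locale hypercube_walk =
  fixes M :: "'a measure" and K :: nat and Y :: "nat \<Rightarrow> 'a \<Rightarrow> nat \<Rightarrow> real"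
  assumes dim_pos: "K \<ge> 1"
    and uniform_srw: "hypercube_srw M K (uniform_count_measure (hypercube K)) Y"

sublocale hypercube_walk \<subseteq> prob_space M
  using uniform_srw by (simp add: hypercube_srw_def)

context hypercube_walk
begin

lemma Y_measurable [measurable]: "Y i \<in> M \<rightarrow>\<^sub>M count_space (hypercube K)"
  using uniform_srw by (simp add: hypercube_srw_def)

lemma Y_in_hypercube [simp]: "\<omega> \<in> space M \<Longrightarrow> Y i \<omega> \<in> hypercube K"
  using measurable_space[OF Y_measurable] by simp

lemma Y_comp_measurable:
  "(\<lambda>\<omega>. h (Y i \<omega>)) \<in> borel_measurable M" for h :: "(nat \<Rightarrow> real) \<Rightarrow> 'b :: topological_space"
  by (rule measurable_compose[OF Y_measurable]) simp

section \<open>The past as a random element of a finite set, and the Markov property\<close>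

text \<open>Restricting to the times up to \<open>i\<close> makes equality of a trajectory with an
  extensional path \<open>p\<close> the same event as in the product form of the Markov
  property.\<close>

definition trajectory :: "nat \<Rightarrow> 'a \<Rightarrow> nat \<Rightarrow> nat \<Rightarrow> real" where
  "trajectory i \<omega> = (\<lambda>j\<in>{..i}. Y j \<omega>)"

lemma trajectory_measurable [measurable]:
  "trajectory i \<in> M \<rightarrow>\<^sub>M count_space ({..i} \<rightarrow>\<^sub>E hypercube K)"
proof (rule measurable_count_space_eq2[THEN iffD2])
  show "finite ({..i} \<rightarrow>\<^sub>E hypercube K)" by (simp add: finite_PiE)
  have "trajectory i -` {p} \<inter> space M \<in> sets M" if "p \<in> {..i} \<rightarrow>\<^sub>E hypercube K" for p
  proof -
    have "trajectory i -` {p} \<inter> space M = {\<omega>\<in>space M. \<forall>j\<in>{..i}. Y j \<omega> = p j}"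
      using that by (auto simp: trajectory_def fun_eq_iff PiE_iff extensional_def)
    also have "\<dots> \<in> sets M"
      by (intro sets.sets_Collect_finite_All pred_count_space_const1 Y_measurable) auto
    finally show ?thesis .
  qed
  then show "trajectory i \<in> space M \<rightarrow> {..i} \<rightarrow>\<^sub>E hypercube K \<and>
    (\<forall>a\<in>{..i} \<rightarrow>\<^sub>E hypercube K. trajectory i -` {a} \<inter> space M \<in> sets M)"
    by (auto simp: trajectory_def)
qed

lemma trajectory_in: "\<omega> \<in> space M \<Longrightarrow> trajectory i \<omega> \<in> {..i} \<rightarrow>\<^sub>E hypercube K"
  by (auto simp: trajectory_def)

lemma trajectory_comp_measurable:
  "(\<lambda>\<omega>. h (trajectory i \<omega>)) \<in> borel_measurable M"
  for h :: "(nat \<Rightarrow> nat \<Rightarrow> real) \<Rightarrow> 'b :: topological_space"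
  by (rule measurable_compose[OF trajectory_measurable]) simp

text \<open>A trajectory takes finitely many values, so any function of it is bounded, for instance
  by the sum of the norms of all its values.\<close>

lemma integrable_trajectory:
  fixes h :: "(nat \<Rightarrow> nat \<Rightarrow> real) \<Rightarrow> 'b :: {banach, second_countable_topology}"
  shows "integrable M (\<lambda>\<omega>. h (trajectory i \<omega>))"
proof (rule integrable_const_bound)
  show "AE \<omega> in M. norm (h (trajectory i \<omega>)) \<le> (\<Sum>p\<in>{..i} \<rightarrow>\<^sub>E hypercube K. norm (h p))"
    by (intro AE_I2 member_le_sum trajectory_in) (auto simp: finite_PiE)
qed (rule trajectory_comp_measurable)

text \<open>Decomposing the space into the finitely many path events turns integrals into sums, to
  which the Markov property applies path by path without conditional expectations.\<close>

lemma integral_trajectory: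
  fixes h :: "(nat \<Rightarrow> nat \<Rightarrow> real) \<Rightarrow> complex"
  shows "(\<integral>\<omega>. h (trajectory i \<omega>) \<partial>M) =
    (\<Sum>p\<in>{..i} \<rightarrow>\<^sub>E hypercube K. prob {\<omega>\<in>space M. trajectory i \<omega> = p} *\<^sub>R h p)"
proof -
  let ?P = "{..i} \<rightarrow>\<^sub>E hypercube K"
  have fin: "finite ?P" by (simp add: finite_PiE)
  have meas: "{\<omega>\<in>space M. trajectory i \<omega> = p} \<in> sets M" if "p \<in> ?P" for p
    using measurable_sets[OF trajectory_measurable, of "{p}" i] that
    by (auto simp: vimage_def Int_def conj_commute)
  have "(\<integral>\<omega>. h (trajectory i \<omega>) \<partial>M) = (\<integral>\<omega>. (\<Sum>p\<in>?P. indicator {\<omega>\<in>space M. trajectory i \<omega> = p} \<omega> *\<^sub>R h p) \<partial>M)"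
  proof (rule Bochner_Integration.integral_cong[OF refl])
    fix \<omega> assume w: "\<omega> \<in> space M"
    have "(\<Sum>p\<in>?P. indicator {\<omega>\<in>space M. trajectory i \<omega> = p} \<omega> *\<^sub>R h p) = (\<Sum>p\<in>?P. if p = trajectory i \<omega> then h p else 0)"
      using w by (intro sum.cong) (auto simp: indicator_def)
    also have "\<dots> = h (trajectory i \<omega>)" using trajectory_in[OF w, of i] fin by simp
    finally show "h (trajectory i \<omega>) = (\<Sum>p\<in>?P. indicator {\<omega>\<in>space M. trajectory i \<omega> = p} \<omega> *\<^sub>R h p)" by simp
  qed
  also have "\<dots> = (\<Sum>p\<in>?P. prob {\<omega>\<in>space M. trajectory i \<omega> = p} *\<^sub>R h p)"
    using meas by (subst Bochner_Integration.integral_sum) (auto simp: emeasure_eq_measure)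
  finally show ?thesis .
qed

lemma prob_trajectory_Suc:
  assumes p: "p \<in> {..i} \<rightarrow>\<^sub>E hypercube K" and w: "w \<in> hypercube K"
  shows "prob {\<omega>\<in>space M. trajectory (Suc i) \<omega> = p(Suc i := w)} =
    prob {\<omega>\<in>space M. trajectory i \<omega> = p} * pmf (srw_step K (p i)) w"
proof -
  let ?q = "p(Suc i := w)"
  have q: "\<forall>j\<le>Suc i. ?q j \<in> hypercube K" using p w by (auto simp: le_Suc_eq)
  have "p j = undefined" if "\<not> j \<le> i" for j
    using PiE_arb[OF p, of j] that by simp
  then have "trajectory (Suc i) \<omega> = ?q \<longleftrightarrow> (\<forall>j\<le>Suc i. Y j \<omega> = ?q j)"
    and "trajectory i \<omega> = p \<longleftrightarrow> (\<forall>j\<le>i. Y j \<omega> = ?q j)" for \<omega>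
    by (auto simp: trajectory_def fun_eq_iff)
  then have 1: "{\<omega>\<in>space M. trajectory (Suc i) \<omega> = ?q} = {\<omega>\<in>space M. \<forall>j\<le>Suc i. Y j \<omega> = ?q j}"
    and 2: "{\<omega>\<in>space M. trajectory i \<omega> = p} = {\<omega>\<in>space M. \<forall>j\<le>i. Y j \<omega> = ?q j}"
    by auto
  have "prob {\<omega>\<in>space M. \<forall>j\<le>Suc i. Y j \<omega> = ?q j} =
    prob {\<omega>\<in>space M. \<forall>j\<le>i. Y j \<omega> = ?q j} * pmf (srw_step K (?q i)) (?q (Suc i))"
    using uniform_srw q unfolding hypercube_srw_def by blast
  then show ?thesis unfolding 1 2 by simp
qed

text \<open>This is the eigenvalue relation conditionally on the past: the test function
  \<open>h\<close> ranges over all functions of the trajectory up to time \<open>i\<close>, and only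
  the sum over the next vertex is evaluated.\<close>

lemma integral_walsh_Suc:
  fixes h :: "(nat \<Rightarrow> nat \<Rightarrow> real) \<Rightarrow> complex"
  assumes S: "S \<subseteq> {1..K}"
  shows "(\<integral>\<omega>. h (trajectory i \<omega>) * walsh S (Y (Suc i) \<omega>) \<partial>M) =
    (1 - 2 * real (card S) / real K) * (\<integral>\<omega>. h (trajectory i \<omega>) * walsh S (Y i \<omega>) \<partial>M)"
proof -
  let ?P = "{..i} \<rightarrow>\<^sub>E hypercube K" and ?\<pi> = "\<lambda>p. prob {\<omega>\<in>space M. trajectory i \<omega> = p}"
  let ?f = "\<lambda>(p, w). p(Suc i := w) :: nat \<Rightarrow> nat \<Rightarrow> real"
  have [simp]: "restrict (trajectory (Suc i) \<omega>) {..i} = trajectory i \<omega>" for \<omega>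
    by (auto simp: trajectory_def)
  have [simp]: "trajectory i \<omega> i = Y i \<omega>" for i \<omega> by (simp add: trajectory_def)
  \<comment> \<open>A path up to time \<open>Suc i\<close> is a path up to time \<open>i\<close>
    together with its last vertex.\<close>
  have bij: "bij_betw ?f (?P \<times> hypercube K) ({..Suc i} \<rightarrow>\<^sub>E hypercube K)"
  proof (rule bij_betw_byWitness[where f' = "\<lambda>q. (restrict q {..i}, q (Suc i))"])
  qed (auto simp: PiE_iff extensional_def fun_eq_iff le_Suc_eq)
  have restr: "restrict (p(Suc i := w)) {..i} = p" if "p \<in> ?P" for p w
    using that by (auto simp: PiE_iff extensional_def fun_eq_iff)
  have "(\<integral>\<omega>. h (trajectory i \<omega>) * walsh S (Y (Suc i) \<omega>) \<partial>M) =
    (\<integral>\<omega>. (\<lambda>q. h (restrict q {..i}) * walsh S (q (Suc i))) (trajectory (Suc i) \<omega>) \<partial>M)"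
    by simp
  also have "\<dots> = (\<Sum>q\<in>{..Suc i} \<rightarrow>\<^sub>E hypercube K. prob {\<omega>\<in>space M. trajectory (Suc i) \<omega> = q} *\<^sub>R
      (h (restrict q {..i}) * walsh S (q (Suc i))))"
    by (rule integral_trajectory)
  also have "\<dots> = (\<Sum>(p, w)\<in>?P \<times> hypercube K. prob {\<omega>\<in>space M. trajectory (Suc i) \<omega> = p(Suc i := w)} *\<^sub>R
      (h p * walsh S w))"
    by (subst sum.reindex_bij_betw[OF bij, symmetric], intro sum.cong refl)
      (auto simp: restr simp del: restrict_fupd)
  also have "\<dots> = (\<Sum>p\<in>?P. \<Sum>w\<in>hypercube K. (?\<pi> p * pmf (srw_step K (p i)) w) *\<^sub>R (h p * walsh S w))"
    by (subst sum.cartesian_product[symmetric]) (intro sum.cong refl, simp add: prob_trajectory_Suc)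
  also have "\<dots> = (\<Sum>p\<in>?P. (?\<pi> p *\<^sub>R h p) * (\<Sum>w\<in>hypercube K. pmf (srw_step K (p i)) w * walsh S w))"
    unfolding of_real_sum sum_distrib_left
    by (intro sum.cong refl) (simp add: scaleR_conv_of_real)
  also have "\<dots> = (\<Sum>p\<in>?P. (?\<pi> p *\<^sub>R h p) * ((1 - 2 * real (card S) / real K) * walsh S (p i)))"
  proof (intro sum.cong refl)
    fix p assume "p \<in> ?P"
    then have "p i \<in> hypercube K" by auto
    from sum_srw_step_walsh[OF this dim_pos S]
    show "?\<pi> p *\<^sub>R h p * complex_of_real (\<Sum>w\<in>hypercube K. pmf (srw_step K (p i)) w * walsh S w) =
      ?\<pi> p *\<^sub>R h p * complex_of_real ((1 - 2 * real (card S) / real K) * walsh S (p i))"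
      by simp
  qed
  also have "\<dots> = (1 - 2 * real (card S) / real K) * (\<Sum>p\<in>?P. ?\<pi> p *\<^sub>R (h p * walsh S (p i)))"
    unfolding sum_distrib_left by (intro sum.cong refl) (simp add: scaleR_conv_of_real)
  also have "(\<Sum>p\<in>?P. ?\<pi> p *\<^sub>R (h p * walsh S (p i))) =
    (\<integral>\<omega>. (\<lambda>p. h p * walsh S (p i)) (trajectory i \<omega>) \<partial>M)"
    by (rule integral_trajectory[symmetric])
  finally show ?thesis by simp
qed

lemma integral_walsh_add:
  fixes h :: "(nat \<Rightarrow> nat \<Rightarrow> real) \<Rightarrow> complex"
  assumes S: "S \<subseteq> {1..K}"
  shows "(\<integral>\<omega>. h (trajectory i \<omega>) * walsh S (Y (i + m) \<omega>) \<partial>M) =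
    (1 - 2 * real (card S) / real K) ^ m * (\<integral>\<omega>. h (trajectory i \<omega>) * walsh S (Y i \<omega>) \<partial>M)"
proof (induction m)
  case (Suc m)
  have [simp]: "restrict (trajectory (i + m) \<omega>) {..i} = trajectory i \<omega>" for \<omega>
    by (auto simp: trajectory_def)
  \<comment> \<open>The one-step relation is applied at time \<open>i + m\<close>, with
    \<open>h\<close> regarded as a function of the longer past through restriction.\<close>
  show ?case
    using integral_walsh_Suc[OF S, of "\<lambda>q. h (restrict q {..i})" "i + m"] Suc by simp
qed simp

section \<open>Orthonormality, Parseval identity and moments at a fixed time\<close>

text \<open>The mean vanishes at time 0 by uniformity, and later steps only multiply it by powers of
  the eigenvalue; stationarity of the uniform law is thus obtained on Walsh functions
  directly.\<close>

lemma expectation_walsh: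
  assumes S: "S \<subseteq> {1..K}"
  shows "(\<integral>\<omega>. complex_of_real (walsh S (Y i \<omega>)) \<partial>M) = (if S = {} then 1 else 0)"
proof (cases "S = {}")
  case False
  have "(\<integral>\<omega>. walsh S (Y 0 \<omega>) \<partial>M) = (\<integral>v. walsh S v \<partial>uniform_count_measure (hypercube K))"
    using uniform_srw by (simp add: hypercube_srw_def integral_distr[symmetric, of _ M "count_space (hypercube K)"])
  also have "\<dots> = (\<Sum>v\<in>hypercube K. walsh S v) / card (hypercube K)"
    unfolding uniform_count_measure_def
    by (subst lebesgue_integral_point_measure_finite) (auto simp: sum_divide_distrib)
  finally have "(\<integral>\<omega>. walsh S (Y 0 \<omega>) \<partial>M) = 0"
    using sum_hypercube_walsh[OF S False] by simp
  then show ?thesis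
    using integral_walsh_add[OF S, of "\<lambda>_. 1" 0 i] False by (simp add: integral_complex_of_real)
qed (simp add: prob_space)

lemma integrable_Y:
  fixes h :: "(nat \<Rightarrow> real) \<Rightarrow> 'b :: {banach, second_countable_topology}"
  shows "integrable M (\<lambda>\<omega>. h (Y i \<omega>))"
  using integrable_trajectory[of "\<lambda>p. h (p i)" i] by (simp add: trajectory_def)

lemma integrable_trajectory_Y:
  fixes h :: "(nat \<Rightarrow> nat \<Rightarrow> real) \<Rightarrow> complex" and k :: "(nat \<Rightarrow> real) \<Rightarrow> complex"
  shows "integrable M (\<lambda>\<omega>. h (trajectory i \<omega>) * k (Y (i + m) \<omega>))"
proof -
  have [simp]: "restrict (trajectory (i + m) \<omega>) {..i} = trajectory i \<omega>" for \<omega>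
    by (auto simp: trajectory_def)
  show ?thesis
    using integrable_trajectory[of "\<lambda>q. h (restrict q {..i}) * k (q (i + m))" "i + m"]
    by (simp add: trajectory_def)
qed

text \<open>The product is the Walsh function of the symmetric difference, whose mean is nonzero
  only if that set is empty.\<close>

lemma walsh_orthonormal:
  assumes "S \<subseteq> {1..K}" "T \<subseteq> {1..K}"
  shows "(\<integral>\<omega>. complex_of_real (walsh S (Y i \<omega>)) * walsh T (Y i \<omega>) \<partial>M) = (if S = T then 1 else 0)"
proof -
  have "(\<integral>\<omega>. complex_of_real (walsh S (Y i \<omega>)) * walsh T (Y i \<omega>) \<partial>M) =
    (\<integral>\<omega>. complex_of_real (walsh ((S - T) \<union> (T - S)) (Y i \<omega>)) \<partial>M)"
    using assms
    by (intro Bochner_Integration.integral_cong refl)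
      (simp flip: of_real_mult add: walsh_mult[OF Y_in_hypercube])
  also have "\<dots> = (if (S - T) \<union> (T - S) = {} then 1 else 0)"
    using assms by (intro expectation_walsh) auto
  also have "(S - T) \<union> (T - S) = {} \<longleftrightarrow> S = T" by blast
  finally show ?thesis .
qed

text \<open>Parseval identity for the orthonormal Walsh functions.\<close>

lemma expectation_norm_walsh_sum:
  fixes a :: "nat set \<Rightarrow> complex"
  shows "(\<integral>\<omega>. (cmod (\<Sum>S\<in>Pow {1..K}. a S * walsh S (Y i \<omega>)))\<^sup>2 \<partial>M) = (\<Sum>S\<in>Pow {1..K}. (cmod (a S))\<^sup>2)"
proof -
  let ?W = "\<lambda>S \<omega>. complex_of_real (walsh S (Y i \<omega>))"
  \<comment> \<open>The squared modulus is written as z times its conjugate; Walsh functions are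
    real, so conjugation touches only the coefficients.\<close>
  have "complex_of_real (\<integral>\<omega>. (cmod (\<Sum>S\<in>Pow {1..K}. a S * ?W S \<omega>))\<^sup>2 \<partial>M) =
    (\<integral>\<omega>. (\<Sum>S\<in>Pow {1..K}. \<Sum>T\<in>Pow {1..K}. (a S * cnj (a T)) * (?W S \<omega> * ?W T \<omega>)) \<partial>M)"
    unfolding integral_complex_of_real[symmetric]
    by (intro Bochner_Integration.integral_cong refl)
      (simp only: complex_norm_square cnj_sum sum_product, simp add: mult_ac)
  also have "\<dots> = (\<Sum>S\<in>Pow {1..K}. \<Sum>T\<in>Pow {1..K}. (a S * cnj (a T)) * (\<integral>\<omega>. ?W S \<omega> * ?W T \<omega> \<partial>M))"
    by (subst Bochner_Integration.integral_sum, rule integrable_Y, intro sum.cong refl,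
        subst Bochner_Integration.integral_sum, rule integrable_Y) simp
  also have "\<dots> = (\<Sum>S\<in>Pow {1..K}. \<Sum>T\<in>Pow {1..K}. if T = S then a S * cnj (a T) else 0)"
    by (intro sum.cong refl) (auto simp: walsh_orthonormal)
  also have "\<dots> = complex_of_real (\<Sum>S\<in>Pow {1..K}. (cmod (a S))\<^sup>2)"
    by (simp add: complex_norm_square[symmetric])
  finally show ?thesis by (simp only: of_real_eq_iff)
qed

text \<open>The coordinate sum is the sum of the K Walsh functions of singletons, and Parseval
  counts them. After division by sqrt K this is the uniform second moment bound that provides
  tightness.\<close>

lemma expectation_coord_sum_sq:
  "(\<integral>\<omega>. (coord_sum K (Y i \<omega>))\<^sup>2 \<partial>M) = real K"
proof -
  define a :: "nat set \<Rightarrow> complex" where "a S = (if card S = 1 then 1 else 0)" for S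
  have card1: "{S \<in> Pow {1..K}. card S = 1} = (\<lambda>c. {c}) ` {1..K}"
    by (auto simp: card_1_singleton_iff)
  have "(\<Sum>S\<in>Pow {1..K}. a S * walsh S v) = coord_sum K v" for v
  proof -
    have "(\<Sum>S\<in>Pow {1..K}. a S * walsh S v) = (\<Sum>S\<in>{S \<in> Pow {1..K}. card S = 1}. walsh S v)"
      by (subst sum.inter_filter) (auto simp: a_def intro!: sum.cong)
    also have "\<dots> = coord_sum K v"
      unfolding card1 by (subst sum.reindex) (auto simp: walsh_def coord_sum_def)
    finally show ?thesis .
  qed
  moreover have "(\<Sum>S\<in>Pow {1..K}. (cmod (a S))\<^sup>2) = real K"
  proof -
    have "(\<Sum>S\<in>Pow {1..K}. (cmod (a S))\<^sup>2) = (\<Sum>S\<in>{S \<in> Pow {1..K}. card S = 1}. 1)"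
      by (subst sum.inter_filter) (auto simp: a_def intro!: sum.cong)
    also have "\<dots> = real K"
      unfolding card1 by (subst sum.reindex) auto
    finally show ?thesis .
  qed
  ultimately show ?thesis using expectation_norm_walsh_sum[of a i] by simp
qed

text \<open>In the Walsh expansion every nonempty set has mean zero, which leaves the coefficient of
  the empty set.\<close>

lemma char_coord_sum:
  "(\<integral>\<omega>. iexp (x * coord_sum K (Y i \<omega>)) \<partial>M) = complex_of_real (cos x ^ K)"
proof -
  let ?c = "\<lambda>S. (\<i> * complex_of_real (sin x)) ^ card S * complex_of_real (cos x) ^ (K - card S)"
  have "(\<integral>\<omega>. iexp (x * coord_sum K (Y i \<omega>)) \<partial>M) =
     (\<integral>\<omega>. (\<Sum>S\<in>Pow {1..K}. ?c S * walsh S (Y i \<omega>)) \<partial>M)"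
    by (intro Bochner_Integration.integral_cong refl) (simp only: iexp_coord_sum_eq_walsh_sum Y_in_hypercube of_real_power)
  also have "\<dots> = (\<Sum>S\<in>Pow {1..K}. ?c S * (\<integral>\<omega>. complex_of_real (walsh S (Y i \<omega>)) \<partial>M))"
    by (subst Bochner_Integration.integral_sum) (auto simp: integrable_Y)
  also have "\<dots> = (\<Sum>S\<in>Pow {1..K}. if S = {} then ?c S else 0)"
    by (intro sum.cong refl, subst expectation_walsh) auto
  also have "\<dots> = complex_of_real (cos x ^ K)" by simp
  finally show ?thesis .
qed

text \<open>The full set \<open>{1..K}\<close> is the only nonempty one whose eigenvalue may exceed \<open>1 - 2 / K\<close> in
  absolute value; its coefficient is \<open>(i sin x)\<^sup>K\<close>.\<close>

lemma decorrelation_bound: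
  fixes h :: "(nat \<Rightarrow> nat \<Rightarrow> real) \<Rightarrow> complex"
  assumes h: "\<And>p. cmod (h p) \<le> 1"
  shows "cmod ((\<integral>\<omega>. h (trajectory i \<omega>) * iexp (x * coord_sum K (Y (i + m) \<omega>)) \<partial>M) -
      complex_of_real (cos x ^ K) * (\<integral>\<omega>. h (trajectory i \<omega>) \<partial>M))
    \<le> sqrt ((1 - 2 / real K) ^ (2 * m) + sin x ^ (2 * K))"
proof -
  let ?lam = "\<lambda>S. 1 - 2 * real (card (S :: nat set)) / real K"
  let ?c = "\<lambda>S. (\<i> * complex_of_real (sin x)) ^ card S * complex_of_real (cos x) ^ (K - card S)"
  \<comment> \<open>These are the Walsh coefficients of the conditional expectation of the character
    given the past, after \<open>m\<close> steps. The empty set is removed because its term is the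
    constant being subtracted.\<close>
  define a where "a S = (if S = {} then 0 else ?c S * ?lam S ^ m)" for S
  let ?D = "\<lambda>\<omega>. \<Sum>S\<in>Pow {1..K}. a S * walsh S (Y i \<omega>)"
  let ?I = "\<lambda>S. \<integral>\<omega>. h (trajectory i \<omega>) * walsh S (Y i \<omega>) \<partial>M"
  have int: "integrable M (\<lambda>\<omega>. h (trajectory i \<omega>) * walsh S (Y (i + m) \<omega>))" for S m
    by (rule integrable_trajectory_Y)
  have "(\<integral>\<omega>. h (trajectory i \<omega>) * iexp (x * coord_sum K (Y (i + m) \<omega>)) \<partial>M) =
    (\<integral>\<omega>. (\<Sum>S\<in>Pow {1..K}. ?c S * (h (trajectory i \<omega>) * walsh S (Y (i + m) \<omega>))) \<partial>M)"
    by (intro Bochner_Integration.integral_cong refl, subst iexp_coord_sum_eq_walsh_sum)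
      (simp_all add: sum_distrib_left mult_ac)
  also have "\<dots> = (\<Sum>S\<in>Pow {1..K}. ?c S * (?lam S ^ m * ?I S))"
    using int by (subst Bochner_Integration.integral_sum) (auto simp: integral_walsh_add intro!: sum.cong)
  also have "\<dots> = complex_of_real (cos x ^ K) * (\<integral>\<omega>. h (trajectory i \<omega>) \<partial>M) + (\<Sum>S\<in>Pow {1..K} - {{}}. ?c S * (?lam S ^ m * ?I S))"
    by (subst sum.remove[of _ "{}"]) auto
  also have "(\<Sum>S\<in>Pow {1..K} - {{}}. ?c S * (?lam S ^ m * ?I S)) = (\<Sum>S\<in>Pow {1..K}. a S * ?I S)"
    by (subst (2) sum.remove[of _ "{}"]) (auto simp: a_def intro!: sum.cong)
  also have "\<dots> = (\<integral>\<omega>. h (trajectory i \<omega>) * ?D \<omega> \<partial>M)"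
    using int[of _ 0] unfolding sum_distrib_left
    by (subst Bochner_Integration.integral_sum) (auto simp: mult.left_commute intro!: sum.cong)
  finally have eq: "(\<integral>\<omega>. h (trajectory i \<omega>) * iexp (x * coord_sum K (Y (i + m) \<omega>)) \<partial>M) -
      complex_of_real (cos x ^ K) * (\<integral>\<omega>. h (trajectory i \<omega>) \<partial>M) = (\<integral>\<omega>. h (trajectory i \<omega>) * ?D \<omega> \<partial>M)" by simp
  have intD: "integrable M (\<lambda>\<omega>. cmod (?D \<omega>))" "integrable M (\<lambda>\<omega>. (cmod (?D \<omega>))\<^sup>2)"
    by (rule integrable_Y)+
  have "cmod (\<integral>\<omega>. h (trajectory i \<omega>) * ?D \<omega> \<partial>M) \<le> (\<integral>\<omega>. cmod (h (trajectory i \<omega>) * ?D \<omega>) \<partial>M)"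
    by (rule integral_norm_bound)
  also have "\<dots> \<le> (\<integral>\<omega>. cmod (?D \<omega>) \<partial>M)"
  proof (rule integral_mono[OF _ intD(1)])
    have "integrable M (\<lambda>\<omega>. h (trajectory i \<omega>) * ?D \<omega>)"
      using integrable_trajectory_Y[of h i "\<lambda>v. \<Sum>S\<in>Pow {1..K}. a S * walsh S v" 0] by simp
    then show "integrable M (\<lambda>\<omega>. cmod (h (trajectory i \<omega>) * ?D \<omega>))" by simp
    show "cmod (h (trajectory i \<omega>) * ?D \<omega>) \<le> cmod (?D \<omega>)" for \<omega>
      unfolding norm_mult by (rule mult_left_le_one_le) (auto simp: h)
  qed
  also have "\<dots> \<le> sqrt (\<integral>\<omega>. (cmod (?D \<omega>))\<^sup>2 \<partial>M)"
  proof (rule real_le_rsqrt)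
    \<comment> \<open>Nonnegativity of the variance is the Cauchy-Schwarz inequality against the
      constant 1.\<close>
    have "0 \<le> variance (\<lambda>\<omega>. cmod (?D \<omega>))" by (rule variance_positive)
    then show "(\<integral>\<omega>. cmod (?D \<omega>) \<partial>M)\<^sup>2 \<le> (\<integral>\<omega>. (cmod (?D \<omega>))\<^sup>2 \<partial>M)"
      unfolding variance_eq[OF intD] by linarith
  qed
  also have "(\<integral>\<omega>. (cmod (?D \<omega>))\<^sup>2 \<partial>M) = (\<Sum>S\<in>Pow {1..K}. (cmod (a S))\<^sup>2)"
    by (rule expectation_norm_walsh_sum)
  also have "\<dots> \<le> (1 - 2 / real K) ^ (2 * m) + sin x ^ (2 * K)"
  proof -
    \<comment> \<open>These are the weights of a random subset that contains each coordinate
      independently with probability (sin x)^2; their total mass 1 makes the bound free of the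
      number of subsets.\<close>
    let ?w = "\<lambda>S. ((sin x)\<^sup>2) ^ card S * ((cos x)\<^sup>2) ^ (K - card S)"
    have sq: "(\<bar>y\<bar> ^ k)\<^sup>2 = (y\<^sup>2) ^ k" for y :: real and k
      by (metis mult.commute power2_abs power_mult)
    have ca: "(cmod (a S))\<^sup>2 = (if S = {} then 0 else ?w S * (?lam S)\<^sup>2 ^ m)" for S
    proof -
      have "cmod (?c S * complex_of_real (?lam S ^ m)) =
        \<bar>sin x\<bar> ^ card S * \<bar>cos x\<bar> ^ (K - card S) * \<bar>?lam S\<bar> ^ m"
        by (simp only: norm_mult norm_power norm_of_real norm_ii mult_1 power_abs)
      then have "(cmod (?c S * complex_of_real (?lam S ^ m)))\<^sup>2 = ?w S * (?lam S)\<^sup>2 ^ m"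
        by (simp only: power_mult_distrib sq)
      then show ?thesis
        unfolding a_def by (cases "S = {}") (simp only: if_True norm_zero, simp, simp only: if_False)
    qed
    \<comment> \<open>Here 1 <= |S| <= K - 1, so K - 2|S| lies between -(K - 2) and K - 2.\<close>
    have lam: "(?lam S)\<^sup>2 \<le> (1 - 2 / real K)\<^sup>2" if "S \<subseteq> {1..K}" "S \<noteq> {}" "S \<noteq> {1..K}" for S
    proof -
      have "card S < K" using psubset_card_mono[of "{1..K}" S] that by auto
      moreover have "card S \<ge> 1" using that finite_subset[of S "{1..K}"] by (simp add: Suc_le_eq card_gt_0_iff)
      ultimately have "\<bar>real K - 2 * real (card S)\<bar> \<le> \<bar>real K - 2\<bar>" by linarith
      then have "\<bar>real K - 2 * real (card S)\<bar> / real K \<le> \<bar>real K - 2\<bar> / real K"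
        by (rule divide_right_mono) simp
      then have "\<bar>?lam S\<bar> \<le> \<bar>1 - 2 / real K\<bar>"
        using dim_pos by (simp add: abs_div_pos diff_divide_distrib)
      then show ?thesis by (simp only: abs_le_square_iff)
    qed
    \<comment> \<open>For the full set the eigenvalue is -1 and its powers do not decay; its entire
      weight is charged to the extra term.\<close>
    have bound: "(cmod (a S))\<^sup>2 \<le> ?w S * (1 - 2 / real K)\<^sup>2 ^ m + (if S = {1..K} then sin x ^ (2 * K) else 0)"
      if "S \<in> Pow {1..K}" for S
    proof (cases "S = {}")
      case True
      then show ?thesis using dim_pos by (auto simp: ca)
    next
      case False
      show ?thesis
      proof (cases "S = {1..K}")
        case True
        then show ?thesis using dim_pos by (simp add: ca flip: power_mult)
      next
        case F: False
        have "?w S * (?lam S)\<^sup>2 ^ m \<le> ?w S * (1 - 2 / real K)\<^sup>2 ^ m"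
          using that False F by (intro mult_left_mono power_mono lam) auto
        then show ?thesis using False F by (simp add: ca)
      qed
    qed
    have "(\<Sum>S\<in>Pow {1..K}. (cmod (a S))\<^sup>2) \<le>
      (\<Sum>S\<in>Pow {1..K}. ?w S * (1 - 2 / real K)\<^sup>2 ^ m + (if S = {1..K} then sin x ^ (2 * K) else 0))"
      by (rule sum_mono) (rule bound)
    also have "\<dots> = (\<Sum>S\<in>Pow {1..K}. ?w S) * (1 - 2 / real K)\<^sup>2 ^ m + sin x ^ (2 * K)"
      by (simp add: sum.distrib sum_distrib_right)
    also have "(\<Sum>S\<in>Pow {1..K}. ?w S) = (\<Prod>c\<in>{1..K}. (sin x)\<^sup>2 + (cos x)\<^sup>2)"
      by (subst prod_add) (auto simp: card_Diff_subset finite_subset intro!: sum.cong)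
    also have "\<dots> = 1" by simp
    finally show ?thesis by (simp add: power_mult)
  qed
  finally show ?thesis unfolding eq by (simp only: real_sqrt_le_mono)
qed

end

section \<open>Convergence of multivariate characteristic functions\<close>

text \<open>Borel sets and product sigma-algebra agree on the full function type, whose index set is
  countable. So \<open>g\<close> is extended there by restriction of its argument, and points of the
  partial product are embedded by filling in zeros.\<close>

lemma borel_measurable_powertop_real:
  fixes g :: "(nat \<Rightarrow> real) \<Rightarrow> real"
  assumes g: "continuous_map (powertop_real I) euclideanreal g"
  shows "g \<in> borel_measurable (\<Pi>\<^sub>M j\<in>I. borel)"
proof -
  define g' where "g' x = g (restrict x I)" for x :: "nat \<Rightarrow> real"
  define e where "e x = (\<lambda>j. if j \<in> I then x j else 0)" for x :: "nat \<Rightarrow> real"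
  have "continuous_map euclidean (powertop_real I) (\<lambda>x :: nat \<Rightarrow> real. restrict x I)"
    by (auto simp: continuous_map_componentwise intro: continuous_intros)
  from continuous_map_compose[OF this g] have "continuous_on UNIV g'"
    by (simp add: g'_def comp_def)
  then have "g' \<in> borel_measurable borel"
    by (rule borel_measurable_continuous_onI)
  then have g': "g' \<in> borel_measurable (\<Pi>\<^sub>M j\<in>UNIV. borel)"
    by (simp cong: measurable_cong_sets add: measurable_cong_sets[OF sets_PiM_equal_borel refl])
  have "e \<in> (\<Pi>\<^sub>M j\<in>I. borel) \<rightarrow>\<^sub>M (\<Pi>\<^sub>M j\<in>UNIV. borel)"
    unfolding e_def
  proof (rule measurable_PiM_single')
    show "(\<lambda>x. if j \<in> I then x j else 0) \<in> borel_measurable (\<Pi>\<^sub>M j\<in>I. borel)" for j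
      by (cases "j \<in> I") auto
  qed auto
  from measurable_compose[OF this g']
  have "(\<lambda>x. g' (e x)) \<in> borel_measurable (\<Pi>\<^sub>M j\<in>I. borel)" .
  moreover have "g' (e x) = g x" if "x \<in> space (\<Pi>\<^sub>M j\<in>I. borel)" for x
  proof -
    have "restrict (e x) I = x"
      using that by (auto simp: e_def space_PiM PiE_iff extensional_def fun_eq_iff)
    then show ?thesis by (simp add: g'_def)
  qed
  ultimately show ?thesis
    by (subst measurable_cong[of _ g "\<lambda>x. g' (e x)"]) auto
qed

section \<open>Trigonometric sums and approximation of bounded continuous functions\<close>

text \<open>The complex linear span of the characters with real frequencies. Generating it by sums
  alone keeps inductions to one character and one linearity step.\<close>

inductive_set trig_sums :: "nat \<Rightarrow> ((nat \<Rightarrow> real) \<Rightarrow> complex) set" for s :: nat where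
  character: "(\<lambda>x. c * iexp (\<Sum>j=1..s. \<theta> j * x j)) \<in> trig_sums s"
| add: "f \<in> trig_sums s \<Longrightarrow> g \<in> trig_sums s \<Longrightarrow> (\<lambda>x. f x + g x) \<in> trig_sums s"

text \<open>Frequencies of characters add under multiplication, and distributivity does the rest;
  this makes the span an algebra, as Stone-Weierstrass requires.\<close>

lemma trig_sums_mult:
  assumes "f \<in> trig_sums s" "g \<in> trig_sums s"
  shows "(\<lambda>x. f x * g x) \<in> trig_sums s"
  using assms(1)
proof induction
  case (character c \<theta>)
  from assms(2) show ?case
  proof induction
    case (character d \<eta>)
    have "(\<lambda>x. c * iexp (\<Sum>j=1..s. \<theta> j * x j) * (d * iexp (\<Sum>j=1..s. \<eta> j * x j)))
      = (\<lambda>x. (c * d) * iexp (\<Sum>j=1..s. (\<theta> j + \<eta> j) * x j))"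
      by (auto simp: distrib_right sum.distrib exp_add distrib_left)
    then show ?case using trig_sums.character[of "c * d" "\<lambda>j. \<theta> j + \<eta> j" s] by simp
  next
    case (add f g)
    then show ?case using trig_sums.add by (fastforce simp: distrib_left)
  qed
next
  case (add f h)
  then show ?case using trig_sums.add by (fastforce simp: distrib_right)
qed

lemma trig_sums_const: "(\<lambda>x. c) \<in> trig_sums s"
  using trig_sums.character[of c "\<lambda>_. 0" s] by simp

text \<open>Euler's formula writes the sine as two characters with frequencies 1 / L and - 1 / L in
  coordinate \<open>j\<close> alone.\<close>

lemma trig_sums_sin:
  assumes "j \<in> {1..s}"
  shows "(\<lambda>x. complex_of_real (sin (x j / L))) \<in> trig_sums s"
proof -
  have sum: "(\<Sum>k=1..s. (if k = j then b else 0) * x k) = b * x j" for b :: real and x :: "nat \<Rightarrow> real"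
    using assms by (simp add: if_distrib[of "\<lambda>z. z * _"] cong: if_cong)
  have 1: "(\<lambda>x. (- \<i> / 2) * iexp (1 / L * x j)) \<in> trig_sums s"
    using trig_sums.character[of "- \<i> / 2" "\<lambda>k. if k = j then 1 / L else 0" s] by (simp only: sum)
  have 2: "(\<lambda>x. (\<i> / 2) * iexp (- 1 / L * x j)) \<in> trig_sums s"
    using trig_sums.character[of "\<i> / 2" "\<lambda>k. if k = j then - 1 / L else 0" s] by (simp only: sum)
  have "complex_of_real (sin y) = (- \<i> / 2) * iexp y + (\<i> / 2) * iexp (- y)" for y
    by (simp add: exp_Euler exp_minus_Euler sin_of_real cos_of_real algebra_simps)
  from this[of "x j / L" for x] show ?thesis
    using trig_sums.add[OF 1 2] by simp
qed

text \<open>Tychonoff's theorem applies once the extensional cube is written as a product over all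
  indices, with the singleton of \<open>undefined\<close> outside \<open>{1..s}\<close>.\<close>

lemma compact_cube: "compact ({1..s :: nat} \<rightarrow>\<^sub>E {-1..1 :: real})"
proof -
  have "({1..s} \<rightarrow>\<^sub>E {-1..1 :: real}) =
    PiE UNIV (\<lambda>j. if j \<in> {1..s} then {-1..1} else {undefined})"
    by (auto simp: PiE_iff extensional_def split: if_splits)
  also have "compactin (product_topology (\<lambda>_. euclideanreal) UNIV) \<dots>"
    by (subst compactin_PiE) auto
  finally show ?thesis by (simp add: euclidean_product_topology)
qed

text \<open>The wave \<open>x \<mapsto> L arcsin (sin (x / L))\<close> is the identity near \<open>0\<close>, takes bounded values and
  depends on \<open>x\<close> through \<open>sin (x / L)\<close> only; so polynomial approximation on the compact cube of
  the values of the sines gives trigonometric sums that are bounded on the whole space.\<close>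

lemma trig_sums_approx:
  fixes g :: "(nat \<Rightarrow> real) \<Rightarrow> real"
  assumes g: "continuous_map (powertop_real {1..s}) euclideanreal g"
    and B: "\<And>x. x \<in> extensional {1..s} \<Longrightarrow> \<bar>g x\<bar> \<le> B"
    and e: "e > 0" and R: "R > 0"
  obtains T where "(\<lambda>x. complex_of_real (T x)) \<in> trig_sums s"
    "\<And>x. x \<in> extensional {1..s} \<Longrightarrow> \<bar>g x - T x\<bar> \<le> e + (2 * B + e) * (\<Sum>j=1..s. (x j / R)\<^sup>2)"
proof -
  \<comment> \<open>With this scale, |x j| <= R means |x j / L| <= pi / 2, exactly the range where
    \<open>arcsin\<close> inverts \<open>sin\<close>.\<close>
  define L where "L = 2 * R / pi"
  have L: "L > 0" using R by (simp add: L_def)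
  define S where "S = ({1..s} \<rightarrow>\<^sub>E {-1..1 :: real})"
  \<comment> \<open>\<open>F\<close> is \<open>g\<close> expressed through the sines: it agrees with
    \<open>g\<close> at \<open>wave x\<close> when \<open>x\<close> lies in the box of radius
    \<open>R\<close>, and is bounded by \<open>B\<close> everywhere.\<close>
  define F where "F u = g (\<lambda>j\<in>{1..s}. L * arcsin (u j))" for u :: "nat \<Rightarrow> real"
  define wave where "wave x = (\<lambda>j\<in>{1..s}. sin (x j / L))" for x :: "nat \<Rightarrow> real"
  \<comment> \<open>\<open>Q\<close> is the algebra for Stone-Weierstrass: it contains the
    coordinate functions, which separate points, and each of its members becomes a trigonometric sum
    on composition with \<open>wave\<close>.\<close>
  define Q where "Q = {p. continuous_on S p \<and> (\<lambda>x. complex_of_real (p (wave x))) \<in> trig_sums s}"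
  have proj: "continuous_on S (\<lambda>u. u j)" for j
    by (rule continuous_on_subset[OF continuous_on_product_coordinates]) simp
  interpret function_ring_on Q S
  proof
    show "compact S" unfolding S_def by (rule compact_cube)
  next
    fix x y :: "nat \<Rightarrow> real" assume xy: "x \<in> S" "y \<in> S" "x \<noteq> y"
    then obtain j where j: "j \<in> {1..s}" "x j \<noteq> y j"
      unfolding S_def by (meson PiE_ext)
    have "(\<lambda>u. u j) \<in> Q"
      using trig_sums_sin[OF j(1), of L] j(1) proj[of j] by (simp add: Q_def wave_def)
    then show "\<exists>f\<in>Q. f x \<noteq> f y" using j(2) by (intro bexI[of _ "\<lambda>u. u j"])
  next
    fix p q assume "p \<in> Q" "q \<in> Q"
    then show "(\<lambda>u. p u + q u) \<in> Q" "(\<lambda>u. p u * q u) \<in> Q"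
      using trig_sums.add[of "\<lambda>x. complex_of_real (p (wave x))" s "\<lambda>x. complex_of_real (q (wave x))"]
        trig_sums_mult[of "\<lambda>x. complex_of_real (p (wave x))" s "\<lambda>x. complex_of_real (q (wave x))"]
      by (simp_all add: Q_def continuous_on_add continuous_on_mult)
  next
    show "(\<lambda>_. c) \<in> Q" for c
      by (simp add: Q_def trig_sums_const)
  qed (simp add: Q_def)
  have "continuous_map (top_of_set S) (powertop_real {1..s}) (\<lambda>u. \<lambda>j\<in>{1..s}. L * arcsin (u j))"
    unfolding continuous_map_componentwise
  proof (intro conjI ballI)
    fix j assume j: "j \<in> {1..s}"
    have "continuous_on S (\<lambda>u. L * arcsin (u j))"
      using j proj by (intro continuous_intros) (auto simp: S_def PiE_iff)
    then show "continuous_map (top_of_set S) euclideanreal (\<lambda>x. (\<lambda>j\<in>{1..s}. L * arcsin (x j)) j)"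
      using j by simp
  qed auto
  from continuous_map_compose[OF this g] have "continuous_on S F"
    by (simp add: F_def comp_def)
  from Stone_Weierstrass_basic[OF this e] obtain p where p: "p \<in> Q"
    "\<And>u. u \<in> S \<Longrightarrow> \<bar>F u - p u\<bar> < e" by blast
  show thesis
  proof (rule that[of "\<lambda>x. p (wave x)"])
    show "(\<lambda>x. complex_of_real (p (wave x))) \<in> trig_sums s" using p by (simp add: Q_def)
    fix x :: "nat \<Rightarrow> real" assume x: "x \<in> extensional {1..s}"
    have waveS: "wave x \<in> S" by (auto simp: wave_def S_def)
    have B0: "B \<ge> 0" using B[OF x] by linarith
    have sum0: "(\<Sum>j=1..s. (x j / R)\<^sup>2) \<ge> 0" by (intro sum_nonneg) auto
    \<comment> \<open>Inside the box the approximation error is at most \<open>e\<close>. Outside,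
      some coordinate exceeds \<open>R\<close>, so the quadratic sum is at least 1 and pays for the
      crude bound \<open>2 * B + e\<close>.\<close>
    show "\<bar>g x - p (wave x)\<bar> \<le> e + (2 * B + e) * (\<Sum>j=1..s. (x j / R)\<^sup>2)"
    proof (cases "\<forall>j\<in>{1..s}. \<bar>x j\<bar> \<le> R")
      case True
      have "L * arcsin (sin (x j / L)) = x j" if "j \<in> {1..s}" for j
      proof -
        have "\<bar>x j\<bar> / L \<le> R / L" using True that L by (intro divide_right_mono) auto
        also have "R / L = pi / 2" using R by (simp add: L_def)
        finally have "\<bar>x j / L\<bar> \<le> pi / 2" using L by simp
        then have "arcsin (sin (x j / L)) = x j / L" by (intro arcsin_sin) linarith+
        then show ?thesis using L by simp
      qed
      then have "(\<lambda>j\<in>{1..s}. L * arcsin (wave x j)) = x"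
        using x by (auto simp: wave_def extensional_def fun_eq_iff)
      then have "F (wave x) = g x" by (simp add: F_def)
      then have "\<bar>g x - p (wave x)\<bar> \<le> e" using p(2)[OF waveS] by simp
      also have "\<dots> \<le> e + (2 * B + e) * (\<Sum>j=1..s. (x j / R)\<^sup>2)"
        using sum0 B0 e by simp
      finally show ?thesis .
    next
      case False
      then obtain k where k: "k \<in> {1..s}" "\<bar>x k\<bar> > R" by force
      have "1 \<le> \<bar>x k / R\<bar>" using k R by simp
      then have "1 \<le> (x k / R)\<^sup>2" using abs_le_square_iff[of 1 "x k / R"] by simp
      also have "\<dots> \<le> (\<Sum>j=1..s. (x j / R)\<^sup>2)"
        using k by (intro member_le_sum) auto
      finally have "(2 * B + e) * 1 \<le> (2 * B + e) * (\<Sum>j=1..s. (x j / R)\<^sup>2)"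
        using B0 e by (intro mult_left_mono) auto
      moreover have "\<bar>g x - p (wave x)\<bar> \<le> e + (2 * B + e) * 1"
      proof -
        have "\<bar>F (wave x)\<bar> \<le> B" unfolding F_def by (intro B) simp
        then have "\<bar>p (wave x)\<bar> \<le> B + e" using p(2)[OF waveS] by linarith
        then have "\<bar>g x - p (wave x)\<bar> \<le> 2 * B + e" using B[OF x] by linarith
        then show ?thesis using e by simp
      qed
      ultimately show ?thesis by (meson add_left_mono order_trans)
    qed
  qed
qed

section \<open>From characteristic functions to convergence in distribution\<close>

lemma trig_sums_integrable:
  assumes "prob_space M" and X: "X \<in> M \<rightarrow>\<^sub>M (\<Pi>\<^sub>M j\<in>{1..s}. borel)" and "f \<in> trig_sums s"
  shows "integrable M (\<lambda>\<omega>. f (X \<omega>))"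
  using assms(3)
proof induction
  case (character c \<theta>)
  interpret prob_space M by fact
  have [measurable]: "(\<lambda>\<omega>. X \<omega> j) \<in> borel_measurable M" if "j \<in> {1..s}" for j
    using measurable_compose[OF X measurable_component_singleton[OF that]] by simp
  show ?case
    by (rule integrable_const_bound[where B = "cmod c"]) (auto simp: norm_mult)
qed auto

lemma trig_sums_tendsto:
  assumes "\<And>n. prob_space (M n)" "prob_space N"
    and X: "\<And>n. X n \<in> M n \<rightarrow>\<^sub>M (\<Pi>\<^sub>M j\<in>{1..s}. borel)" and Z: "Z \<in> N \<rightarrow>\<^sub>M (\<Pi>\<^sub>M j\<in>{1..s}. borel)"
    and char: "\<And>\<theta>. (\<lambda>n. \<integral>\<omega>. iexp (\<Sum>j=1..s. \<theta> j * X n \<omega> j) \<partial>M n)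
      \<longlonglongrightarrow> (\<integral>\<omega>. iexp (\<Sum>j=1..s. \<theta> j * Z \<omega> j) \<partial>N)"
    and "f \<in> trig_sums s"
  shows "(\<lambda>n. \<integral>\<omega>. f (X n \<omega>) \<partial>M n) \<longlonglongrightarrow> (\<integral>\<omega>. f (Z \<omega>) \<partial>N)"
  using assms(6)
proof induction
  case (character c \<theta>)
  show ?case using tendsto_mult[OF tendsto_const[of c] char[of \<theta>]] by simp
next
  case (add f g)
  then show ?case
    using trig_sums_integrable[OF assms(1) X] trig_sums_integrable[OF assms(2) Z]
    by (simp add: tendsto_add)
qed

text \<open>A version of Levy's continuity theorem with known limit, in which second moments replace
  tightness: they integrate the quadratic error of the trigonometric approximation, uniformly in
  \<open>n\<close>.\<close>

theorem conv_in_distribution_if_char_tendsto: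
  fixes M :: "nat \<Rightarrow> 'a measure" and N :: "'b measure"
  assumes M: "\<And>n. prob_space (M n)" and N: "prob_space N"
    and X: "\<And>n. X n \<in> M n \<rightarrow>\<^sub>M (\<Pi>\<^sub>M j\<in>{1..s}. borel)" and Z: "Z \<in> N \<rightarrow>\<^sub>M (\<Pi>\<^sub>M j\<in>{1..s}. borel)"
    and X2: "\<And>n j. j \<in> {1..s} \<Longrightarrow> integrable (M n) (\<lambda>\<omega>. (X n \<omega> j)\<^sup>2)"
      "\<And>n j. j \<in> {1..s} \<Longrightarrow> (\<integral>\<omega>. (X n \<omega> j)\<^sup>2 \<partial>M n) \<le> C"
    and Z2: "\<And>j. j \<in> {1..s} \<Longrightarrow> integrable N (\<lambda>\<omega>. (Z \<omega> j)\<^sup>2)"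
      "\<And>j. j \<in> {1..s} \<Longrightarrow> (\<integral>\<omega>. (Z \<omega> j)\<^sup>2 \<partial>N) \<le> C"
    and char: "\<And>\<theta>. (\<lambda>n. \<integral>\<omega>. iexp (\<Sum>j=1..s. \<theta> j * X n \<omega> j) \<partial>M n)
      \<longlonglongrightarrow> (\<integral>\<omega>. iexp (\<Sum>j=1..s. \<theta> j * Z \<omega> j) \<partial>N)"
  shows "conv_in_distribution s M X N Z"
  unfolding conv_in_distribution_def
proof (intro conjI allI impI)
  fix g :: "(nat \<Rightarrow> real) \<Rightarrow> real"
  assume g: "continuous_map (powertop_real {1..s}) euclideanreal g"
    and bdd: "bounded (g ` topspace (powertop_real {1..s}))"
  from bdd obtain B where B: "B > 0" "\<And>x. x \<in> extensional {1..s} \<Longrightarrow> \<bar>g x\<bar> \<le> B"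
    unfolding bounded_pos by (auto simp: PiE_def)
  note gmeas = borel_measurable_powertop_real[OF g]
  show "(\<lambda>n. \<integral>\<omega>. g (X n \<omega>) \<partial>M n) \<longlonglongrightarrow> (\<integral>\<omega>. g (Z \<omega>) \<partial>N)"
  proof (rule LIMSEQ_I)
    fix r :: real assume "r > 0"
    \<comment> \<open>Two approximation errors of size 2e, one for \<open>X n\<close> and one for
      \<open>Z\<close>, and one convergence error below e add up to less than r.\<close>
    define e where "e = r / 5"
    have e: "e > 0" using \<open>r > 0\<close> by (simp add: e_def)
    \<comment> \<open>The expected quadratic penalty is at most \<open>C' / R\<^sup>2\<close>; the
      choice of \<open>R\<close> makes this at most \<open>e\<close>. The absolute value of
      \<open>C\<close> gives \<open>C' \<ge> 0\<close> whatever the sign of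
      \<open>C\<close>.\<close>
    define C' where "C' = (2 * B + e) * (real s * \<bar>C\<bar>)"
    define R where "R = 1 + C' / e"
    have C': "C' \<ge> 0" using B e by (simp add: C'_def)
    have R1: "R \<ge> 1" using C' e by (simp add: R_def)
    have "C' \<le> e * R" using e by (simp add: R_def field_simps)
    also have "\<dots> \<le> e * R\<^sup>2" using R1 e by (simp add: power2_eq_square)
    finally have CR: "C' / R\<^sup>2 \<le> e" using R1 by (simp add: divide_le_eq)
    obtain T where T: "(\<lambda>x. complex_of_real (T x)) \<in> trig_sums s"
      "\<And>x. x \<in> extensional {1..s} \<Longrightarrow> \<bar>g x - T x\<bar> \<le> e + (2 * B + e) * (\<Sum>j=1..s. (x j / R)\<^sup>2)"
      using trig_sums_approx[OF g B(2) e, of R] R1 by auto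
    \<comment> \<open>The underlying space is left general because the estimate serves both the
      approximating vectors and the limit.\<close>
    have close: "\<bar>(\<integral>\<omega>. g (W \<omega>) \<partial>P) - (\<integral>\<omega>. T (W \<omega>) \<partial>P)\<bar> \<le> 2 * e"
      if P: "prob_space P" and W: "W \<in> P \<rightarrow>\<^sub>M (\<Pi>\<^sub>M j\<in>{1..s}. borel)"
        and W2: "\<And>j. j \<in> {1..s} \<Longrightarrow> integrable P (\<lambda>\<omega>. (W \<omega> j)\<^sup>2)"
          "\<And>j. j \<in> {1..s} \<Longrightarrow> (\<integral>\<omega>. (W \<omega> j)\<^sup>2 \<partial>P) \<le> C"
      for P :: "'c measure" and W
    proof -
      interpret prob_space P by fact
      have ext: "W \<omega> \<in> extensional {1..s}" if "\<omega> \<in> space P" for \<omega>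
        using measurable_space[OF W that] by (simp add: space_PiM PiE_def)
      have ig: "integrable P (\<lambda>\<omega>. g (W \<omega>))"
        using measurable_compose[OF W gmeas] B(2)[OF ext]
        by (intro integrable_const_bound[where B = B]) auto
      have iT: "integrable P (\<lambda>\<omega>. T (W \<omega>))"
        using trig_sums_integrable[OF P W T(1)] by (simp only: complex_of_real_integrable_eq)
      have iq: "integrable P (\<lambda>\<omega>. (W \<omega> j / R)\<^sup>2)" if "j \<in> {1..s}" for j
        using W2(1)[OF that] by (simp add: power_divide)
      then have isum: "integrable P (\<lambda>\<omega>. \<Sum>j=1..s. (W \<omega> j / R)\<^sup>2)"
        by (rule Bochner_Integration.integrable_sum)
      have "\<bar>(\<integral>\<omega>. g (W \<omega>) \<partial>P) - (\<integral>\<omega>. T (W \<omega>) \<partial>P)\<bar> = \<bar>\<integral>\<omega>. g (W \<omega>) - T (W \<omega>) \<partial>P\<bar>"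
        using ig iT by simp
      also have "\<dots> \<le> (\<integral>\<omega>. \<bar>g (W \<omega>) - T (W \<omega>)\<bar> \<partial>P)"
        by (rule integral_abs_bound)
      also have "\<dots> \<le> (\<integral>\<omega>. e + (2 * B + e) * (\<Sum>j=1..s. (W \<omega> j / R)\<^sup>2) \<partial>P)"
      proof (rule integral_mono)
        show "integrable P (\<lambda>\<omega>. \<bar>g (W \<omega>) - T (W \<omega>)\<bar>)"
          by (intro integrable_abs Bochner_Integration.integrable_diff ig iT)
        show "integrable P (\<lambda>\<omega>. e + (2 * B + e) * (\<Sum>j=1..s. (W \<omega> j / R)\<^sup>2))"
          by (intro Bochner_Integration.integrable_add integrable_mult_right isum integrable_const)
      qed (rule T(2)[OF ext])
      also have "\<dots> = e + (2 * B + e) * (\<Sum>j=1..s. (\<integral>\<omega>. (W \<omega> j)\<^sup>2 \<partial>P) / R\<^sup>2)"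
      proof -
        have "(\<integral>\<omega>. (\<Sum>j=1..s. (W \<omega> j / R)\<^sup>2) \<partial>P) = (\<Sum>j=1..s. (\<integral>\<omega>. (W \<omega> j)\<^sup>2 \<partial>P) / R\<^sup>2)"
          using iq by (subst Bochner_Integration.integral_sum) (auto simp: power_divide)
        then show ?thesis using isum by (simp add: prob_space del: One_nat_def)
      qed
      also have "\<dots> \<le> e + (2 * B + e) * (\<Sum>j=1..s. \<bar>C\<bar> / R\<^sup>2)"
      proof -
        have "(\<integral>\<omega>. (W \<omega> j)\<^sup>2 \<partial>P) \<le> \<bar>C\<bar>" if "j \<in> {1..s}" for j
          using W2(2)[OF that] by linarith
        then show ?thesis
          using B e by (intro add_left_mono mult_left_mono sum_mono divide_right_mono) auto
      qed
      also have "\<dots> = e + C' / R\<^sup>2" by (simp add: C'_def)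
      also have "\<dots> \<le> 2 * e" using CR by simp
      finally show ?thesis .
    qed
    have "(\<lambda>n. complex_of_real (\<integral>\<omega>. T (X n \<omega>) \<partial>M n)) \<longlonglongrightarrow> complex_of_real (\<integral>\<omega>. T (Z \<omega>) \<partial>N)"
      using trig_sums_tendsto[OF M N X Z char T(1)] by simp
    then have "(\<lambda>n. \<integral>\<omega>. T (X n \<omega>) \<partial>M n) \<longlonglongrightarrow> (\<integral>\<omega>. T (Z \<omega>) \<partial>N)"
      by (simp only: tendsto_of_real_iff)
    from LIMSEQ_D[OF this e] obtain n0 where
      n0: "\<And>n. n \<ge> n0 \<Longrightarrow> \<bar>(\<integral>\<omega>. T (X n \<omega>) \<partial>M n) - (\<integral>\<omega>. T (Z \<omega>) \<partial>N)\<bar> < e"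
      by auto
    have "norm ((\<integral>\<omega>. g (X n \<omega>) \<partial>M n) - (\<integral>\<omega>. g (Z \<omega>) \<partial>N)) < r" if "n \<ge> n0" for n
    proof -
      have "\<bar>(\<integral>\<omega>. g (X n \<omega>) \<partial>M n) - (\<integral>\<omega>. T (X n \<omega>) \<partial>M n)\<bar> \<le> 2 * e"
        by (rule close[OF M X X2])
      moreover have "\<bar>(\<integral>\<omega>. g (Z \<omega>) \<partial>N) - (\<integral>\<omega>. T (Z \<omega>) \<partial>N)\<bar> \<le> 2 * e"
        by (rule close[OF N Z Z2])
      ultimately show ?thesis
        using n0[OF that] unfolding e_def real_norm_def by linarith
    qed
    then show "\<exists>n0. \<forall>n\<ge>n0. norm ((\<integral>\<omega>. g (X n \<omega>) \<partial>M n) - (\<integral>\<omega>. g (Z \<omega>) \<partial>N)) < r" by blast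
  qed
qed (use X Z in auto)

section \<open>Joint characteristic functions of the walk\<close>

text \<open>Since cos (c / sqrt k) = 1 - c^2 / (2k) + o(1/k), its k-th power has the Gaussian
  limit.\<close>

lemma cos_power_tendsto:
  assumes "filterlim K at_top F"
  shows "((\<lambda>n. cos (c / sqrt (real (K n))) ^ K n) \<longlongrightarrow> exp (- c\<^sup>2 / 2)) F"
proof -
  have "(\<lambda>k. cos (c / sqrt (real k)) ^ k) \<longlonglongrightarrow> exp (- c\<^sup>2 / 2)"
    unfolding power2_eq_square by real_asymp
  then show ?thesis by (rule filterlim_compose[OF _ assms])
qed

text \<open>The squared sine is at most c^2 / k, hence at most 1/2 for large k, and the k-th power
  is dominated by a geometric sequence.\<close>

lemma sin_power_tendsto_0:
  assumes "filterlim K at_top F"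
  shows "((\<lambda>n. sin (c / sqrt (real (K n))) ^ (2 * K n)) \<longlongrightarrow> 0) F"
proof -
  have "(\<lambda>k. sin (c / sqrt (real k)) ^ (2 * k)) \<longlonglongrightarrow> 0"
  proof (rule tendsto_sandwich)
    show "\<forall>\<^sub>F k in sequentially. 0 \<le> sin (c / sqrt (real k)) ^ (2 * k)"
      by (simp add: power_mult)
    \<comment> \<open>The threshold ensures both k > 0 and c^2 / k <= 1/2.\<close>
    have "\<forall>\<^sub>F k in sequentially. real k \<ge> 1 + 2 * c\<^sup>2" by real_asymp
    then show "\<forall>\<^sub>F k in sequentially. sin (c / sqrt (real k)) ^ (2 * k) \<le> (1 / 2) ^ k"
    proof eventually_elim
      case (elim k)
      have "real k > 0" using elim by (smt (verit) zero_le_power2)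
      have "(sin (c / sqrt (real k)))\<^sup>2 \<le> (c / sqrt (real k))\<^sup>2"
        using abs_sin_x_le_abs_x by (simp only: abs_le_square_iff[symmetric])
      also have "\<dots> = c\<^sup>2 / real k" by (simp add: power_divide)
      also have "\<dots> \<le> 1 / 2" using elim \<open>real k > 0\<close> by (simp add: field_simps)
      finally show ?case unfolding power_mult by (intro power_mono) auto
    qed
    show "(\<lambda>k. (1 / 2) ^ k :: real) \<longlonglongrightarrow> 0" by real_asymp
  qed simp
  then show ?thesis by (rule filterlim_compose[OF _ assms])
qed

text \<open>From 1 - y <= exp (- y) with y = 2 / K, the power is at most exp (- 4 m / K).\<close>

lemma second_eigenvalue_power_tendsto_0:
  fixes K m :: "'a \<Rightarrow> nat"
  assumes K: "filterlim K at_top F" and m: "filterlim (\<lambda>n. real (m n) / real (K n)) at_top F"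
  shows "((\<lambda>n. (1 - 2 / real (K n)) ^ (2 * m n)) \<longlongrightarrow> 0) F"
proof (rule tendsto_sandwich)
  show "\<forall>\<^sub>F n in F. 0 \<le> (1 - 2 / real (K n)) ^ (2 * m n)"
    by (simp add: power_mult)
  \<comment> \<open>For K >= 2 the base is nonnegative, so the exponential inequality can be raised
    to a power.\<close>
  have "\<forall>\<^sub>F n in F. K n \<ge> 2" using K by (simp add: filterlim_at_top)
  then show "\<forall>\<^sub>F n in F. (1 - 2 / real (K n)) ^ (2 * m n) \<le> exp (- 4 * (real (m n) / real (K n)))"
  proof eventually_elim
    case (elim n)
    have "(1 - 2 / real (K n)) ^ (2 * m n) \<le> exp (- 2 / real (K n)) ^ (2 * m n)"
      using elim exp_ge_add_one_self[of "- 2 / real (K n)"] by (intro power_mono) auto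
    also have "\<dots> = exp (- 4 * (real (m n) / real (K n)))"
      by (simp add: exp_of_nat_mult[symmetric])
    finally show ?case .
  qed
  have "((\<lambda>y :: real. exp (- 4 * y)) \<longlongrightarrow> 0) at_top" by real_asymp
  from filterlim_compose[OF this m]
  show "((\<lambda>n. exp (- 4 * (real (m n) / real (K n)))) \<longlongrightarrow> 0) F" .
qed simp

lemma nat_floor_diff_ge:
  fixes a b :: real
  assumes "a \<ge> 0" "b \<ge> 0"
  shows "real (nat \<lfloor>a\<rfloor> - nat \<lfloor>b\<rfloor>) \<ge> a - b - 1"
proof -
  have "real (nat \<lfloor>a\<rfloor>) \<ge> a - 1" "real (nat \<lfloor>b\<rfloor>) \<le> b" using assms by linarith+
  then show ?thesis by linarith
qed

section \<open>Factorization of the joint characteristic functions in the limit\<close>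

text \<open>Induction on the number of times: the last character is replaced by its mean at the cost
  of the decorrelation error, the earlier ones forming a function of the past. Order of the times is
  required only eventually, which is all that diverging gaps provide.\<close>

lemma walk_char_tendsto:
  fixes K :: "nat \<Rightarrow> nat" and Y :: "nat \<Rightarrow> nat \<Rightarrow> 'a \<Rightarrow> nat \<Rightarrow> real" and \<theta> :: "nat \<Rightarrow> real"
  assumes walk: "\<And>n. hypercube_walk (M n) (K n) (Y n)"
    and K: "filterlim K at_top sequentially"
    and mono: "\<And>j. j \<in> {1..<s} \<Longrightarrow> \<forall>\<^sub>F n in sequentially. m n j \<le> m n (Suc j)"
    and gap: "\<And>j. j \<in> {1..<s} \<Longrightarrow>
      filterlim (\<lambda>n. real (m n (Suc j) - m n j) / real (K n)) at_top sequentially"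
    and "r \<le> s"
  shows "(\<lambda>n. \<integral>\<omega>. (\<Prod>j=1..r. iexp (\<theta> j / sqrt (real (K n)) * coord_sum (K n) (Y n (m n j) \<omega>))) \<partial>M n)
    \<longlonglongrightarrow> complex_of_real (\<Prod>j=1..r. exp (- (\<theta> j)\<^sup>2 / 2))"
  using \<open>r \<le> s\<close>
proof (induction r)
  case 0
  have "prob_space (M n)" for n
    using walk[of n] by (simp add: hypercube_walk_def hypercube_srw_def)
  then show ?case by (simp add: prob_space.prob_space)
next
  case (Suc r)
  define x where "x n = \<theta> (Suc r) / sqrt (real (K n))" for n
  define E where "E n j \<omega> = iexp (\<theta> j / sqrt (real (K n)) * coord_sum (K n) (Y n (m n j) \<omega>))" for n j \<omega>
  let ?J = "\<lambda>r n. \<integral>\<omega>. (\<Prod>j=1..r. E n j \<omega>) \<partial>M n"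
  have cos: "(\<lambda>n. complex_of_real (cos (x n) ^ K n)) \<longlonglongrightarrow> exp (- (\<theta> (Suc r))\<^sup>2 / 2)"
    unfolding x_def by (intro tendsto_of_real cos_power_tendsto K)
  show ?case
  proof (cases "r = 0")
    \<comment> \<open>The first time has no predecessor and no gap; its characteristic function is
      known exactly.\<close>
    case True
    have "?J 1 n = cos (x n) ^ K n" for n
      using hypercube_walk.char_coord_sum[OF walk, of n "x n" "m n 1"] True
      by (simp add: E_def x_def)
    then show ?thesis using cos True by (simp add: E_def)
  next
    case False
    then have r: "r \<in> {1..<s}" using Suc.prems by auto
    have IH: "?J r \<longlonglongrightarrow> complex_of_real (\<Prod>j=1..r. exp (- (\<theta> j)\<^sup>2 / 2))"
      using Suc by (simp add: E_def)
    have "\<forall>\<^sub>F n in sequentially. \<forall>j\<in>{1..<s}. m n j \<le> m n (Suc j)"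
      by (intro eventually_ball_finite) (auto intro: mono)
    then have bound: "\<forall>\<^sub>F n in sequentially. norm (?J (Suc r) n - complex_of_real (cos (x n) ^ K n) * ?J r n) \<le>
      sqrt ((1 - 2 / real (K n)) ^ (2 * (m n (Suc r) - m n r)) + sin (x n) ^ (2 * K n))"
    proof eventually_elim
      case (elim n)
      interpret hypercube_walk "M n" "K n" "Y n" by (rule walk)
      \<comment> \<open>Chaining consecutive inequalities places all earlier times in the past of
        \<open>m n r\<close>, so their characters are functions of that trajectory.\<close>
      have le: "m n j \<le> m n r" if "j \<in> {1..r}" for j
      proof -
        have "m n j \<le> m n (j + d)" if "j + d \<le> r" for d
          using that
        proof (induction d)
          case (Suc d)
          moreover have "m n (j + d) \<le> m n (Suc (j + d))"
            using elim r \<open>j \<in> {1..r}\<close> Suc.prems by auto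
          ultimately show ?case by simp
        qed simp
        from this[of "r - j"] show ?thesis using that by simp
      qed
      have next_le: "m n r \<le> m n (Suc r)" using elim r by blast
      define h where "h p = (\<Prod>j=1..r. iexp (\<theta> j / sqrt (real (K n)) * coord_sum (K n) (p (m n j))))"
        for p :: "nat \<Rightarrow> nat \<Rightarrow> real"
      have hE: "h (trajectory (m n r) \<omega>) = (\<Prod>j=1..r. E n j \<omega>)" for \<omega>
        unfolding h_def E_def using le by (intro prod.cong) (auto simp: trajectory_def)
      have h1: "cmod (h p) \<le> 1" for p
        by (simp add: h_def prod_norm[symmetric])
      have "?J (Suc r) n = (\<integral>\<omega>. h (trajectory (m n r) \<omega>) *
          iexp (x n * coord_sum (K n) (Y n (m n r + (m n (Suc r) - m n r)) \<omega>)) \<partial>M n)"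
        using next_le by (simp add: hE E_def x_def)
      then show ?case
        using decorrelation_bound[where h = h and i = "m n r" and x = "x n" and
            m = "m n (Suc r) - m n r", OF h1]
        by (simp only: hE)
    qed
    have lim0: "(\<lambda>n. sqrt ((1 - 2 / real (K n)) ^ (2 * (m n (Suc r) - m n r)) + sin (x n) ^ (2 * K n)))
      \<longlonglongrightarrow> 0"
      using tendsto_real_sqrt[OF tendsto_add[OF second_eigenvalue_power_tendsto_0[OF K gap[OF r]]
          sin_power_tendsto_0[OF K, of "\<theta> (Suc r)"]]] by (simp add: x_def)
    have "(\<lambda>n. ?J (Suc r) n - complex_of_real (cos (x n) ^ K n) * ?J r n) \<longlonglongrightarrow> 0"
      by (rule Lim_null_comparison[OF bound lim0])
    from tendsto_add[OF this tendsto_mult[OF cos IH]]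
    have "?J (Suc r) \<longlonglongrightarrow> complex_of_real (exp (- (\<theta> (Suc r))\<^sup>2 / 2)) *
        complex_of_real (\<Prod>j=1..r. exp (- (\<theta> j)\<^sup>2 / 2))"
      by simp
    then show ?thesis by (simp add: E_def mult.commute)
  qed
qed

section \<open>Characteristic function and second moment of the Gaussian limit\<close>

lemma (in prob_space) char_indep_std_normal:
  assumes "finite I" and indep: "indep_vars (\<lambda>_. borel) G I"
    and normal: "\<And>j. j \<in> I \<Longrightarrow> distributed M lborel (G j) std_normal_density"
  shows "(\<integral>\<omega>. iexp (\<Sum>j\<in>I. \<theta> j * G j \<omega>) \<partial>M) = complex_of_real (\<Prod>j\<in>I. exp (- (\<theta> j)\<^sup>2 / 2))"
proof -
  have rv: "random_variable borel (G j)" if "j \<in> I" for j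
    using distributed_measurable[OF normal[OF that]] by simp
  have char: "(\<integral>\<omega>. iexp (\<theta> j * G j \<omega>) \<partial>M) = exp (- (\<theta> j)\<^sup>2 / 2)" if "j \<in> I" for j
  proof -
    have "(\<integral>\<omega>. iexp (\<theta> j * G j \<omega>) \<partial>M) = (\<integral>y. iexp (\<theta> j * y) \<partial>distr M lborel (G j))"
      using rv[OF that] by (subst integral_distr) auto
    also have "\<dots> = char std_normal_distribution (\<theta> j)"
      by (simp add: distributed_distr_eq_density[OF normal[OF that]] char_def)
    also have "\<dots> = exp (- (\<theta> j)\<^sup>2 / 2)" by (simp add: char_std_normal_distribution)
    finally show ?thesis .
  qed
  have "(\<integral>\<omega>. iexp (\<Sum>j\<in>I. \<theta> j * G j \<omega>) \<partial>M) = (\<integral>\<omega>. (\<Prod>j\<in>I. iexp (\<theta> j * G j \<omega>)) \<partial>M)"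
    using \<open>finite I\<close> by (simp add: sum_distrib_left exp_sum)
  also have "\<dots> = (\<Prod>j\<in>I. \<integral>\<omega>. iexp (\<theta> j * G j \<omega>) \<partial>M)"
  proof (rule indep_vars_lebesgue_integral[OF \<open>finite I\<close>])
    show "indep_vars (\<lambda>_. borel) (\<lambda>j \<omega>. iexp (\<theta> j * G j \<omega>)) I"
      by (rule indep_vars_compose2[OF indep]) simp
    show "integrable M (\<lambda>\<omega>. iexp (\<theta> j * G j \<omega>))" if "j \<in> I" for j
      using rv[OF that] by (intro integrable_const_bound[where B = 1]) auto
  qed
  also have "\<dots> = complex_of_real (\<Prod>j\<in>I. exp (- (\<theta> j)\<^sup>2 / 2))"
    using char by (simp add: of_real_prod)
  finally show ?thesis .
qed

lemma (in prob_space) std_normal_second_moment: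
  assumes "distributed M lborel G std_normal_density"
  shows "integrable M (\<lambda>\<omega>. (G \<omega>)\<^sup>2)" and "(\<integral>\<omega>. (G \<omega>)\<^sup>2 \<partial>M) = 1"
proof -
  \<comment> \<open>The even moment formula with k = 1 gives 2! / (2 * 1!) = 1.\<close>
  have "has_bochner_integral lborel (\<lambda>x. std_normal_density x * x ^ (2 * 1)) (fact (2 * 1) / (2 ^ 1 * fact 1))"
    by (rule std_normal_moment_even)
  then have 1: "has_bochner_integral lborel (\<lambda>x. std_normal_density x * x\<^sup>2) 1"
    by simp
  show "integrable M (\<lambda>\<omega>. (G \<omega>)\<^sup>2)"
    using distributed_integrable[OF assms, of "\<lambda>x. x\<^sup>2"] 1 by (simp add: has_bochner_integral_iff)
  show "(\<integral>\<omega>. (G \<omega>)\<^sup>2 \<partial>M) = 1"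
    using distributed_integral[OF assms, of "\<lambda>x. x\<^sup>2"] 1 by (simp add: has_bochner_integral_iff)
qed

section \<open>Passage from real times to step counts, and the conclusion\<close>

text \<open>The walk in dimension \<open>k\<close> lives on its own space \<open>M k\<close>, so the
  n-th vector lives on \<open>M (K n)\<close>. The limit may be any independent standard normal
  family on any probability space.\<close>

theorem theorem2:
  fixes K :: "nat \<Rightarrow> nat"
    and M :: "nat \<Rightarrow> 'a measure"
    and Y :: "nat \<Rightarrow> nat \<Rightarrow> 'a \<Rightarrow> nat \<Rightarrow> real"
    and s :: nat
    and t :: "nat \<Rightarrow> nat \<Rightarrow> real"
    and N :: "'b measure"
    and G :: "nat \<Rightarrow> 'b \<Rightarrow> real"
  assumes K_pos: "\<And>n. K n \<ge> 1"
    and K_lim: "filterlim K at_top sequentially"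
    and nK_lim: "filterlim (\<lambda>n. real n / real (K n)) at_top sequentially"
    and srw: "\<And>k. k \<ge> 1 \<Longrightarrow>
      hypercube_srw (M k) k (uniform_count_measure (hypercube k)) (Y k)"
    and s_pos: "s \<ge> 1"
    and t_nonneg: "\<And>n j. j \<in> {1..s} \<Longrightarrow> t n j \<ge> 0"
    and t_gap: "\<And>j. j \<in> {1..<s} \<Longrightarrow>
      filterlim (\<lambda>n. real n / real (K n) * (t n (j + 1) - t n j)) at_top sequentially"
    and N_prob: "prob_space N"
    and G_indep: "prob_space.indep_vars N (\<lambda>_. borel) G {1..s}"
    and G_normal: "\<And>j. j \<in> {1..s} \<Longrightarrow> distributed N lborel (G j) std_normal_density"
  shows "conv_in_distribution s (\<lambda>n. M (K n))
    (\<lambda>n \<omega>. \<lambda>j\<in>{1..s}. 1 / sqrt (real (K n)) * scaled_walk Y n (K n) (t n j) \<omega>)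
    N (\<lambda>\<omega>. \<lambda>j\<in>{1..s}. G j \<omega>)"
proof -
  interpret N: prob_space N by (rule N_prob)
  define m where "m n j = nat \<lfloor>real n * t n j\<rfloor>" for n j
  have walk: "hypercube_walk (M (K n)) (K n) (Y (K n))" for n
    using K_pos srw by unfold_locales auto
  have P: "prob_space (M (K n))" for n
    using srw[OF K_pos] by (simp add: hypercube_srw_def)
  have walk_eq: "scaled_walk Y n (K n) (t n j) \<omega> = coord_sum (K n) (Y (K n) (m n j) \<omega>)" for n j \<omega>
    by (simp add: scaled_walk_def m_def)
  have mono: "\<forall>\<^sub>F n in sequentially. m n j \<le> m n (Suc j)" if j: "j \<in> {1..<s}" for j
  proof -
    \<comment> \<open>A diverging gap is eventually positive, which orders the real times and, by
      monotonicity of the floor, the step counts.\<close>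
    have "\<forall>\<^sub>F n in sequentially. real n / real (K n) * (t n (j + 1) - t n j) > 0"
      using t_gap[OF j] by (simp only: filterlim_at_top_dense)
    then show ?thesis
    proof eventually_elim
      case (elim n)
      then have "t n j \<le> t n (Suc j)"
        using mult_nonneg_nonpos[of "real n / real (K n)" "t n (j + 1) - t n j"] by fastforce
      then show ?case unfolding m_def by (intro nat_mono floor_mono mult_left_mono) auto
    qed
  qed
  have gap: "filterlim (\<lambda>n. real (m n (Suc j) - m n j) / real (K n)) at_top sequentially"
    if j: "j \<in> {1..<s}" for j
  proof (rule filterlim_at_top_mono)
    \<comment> \<open>Rounding costs at most one step, and 1 <= K, so after division by K the loss
      is at most 1.\<close>
    show "filterlim (\<lambda>n. - 1 + real n / real (K n) * (t n (j + 1) - t n j)) at_top sequentially"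
      by (rule filterlim_tendsto_add_at_top[OF tendsto_const t_gap[OF j]])
    show "\<forall>\<^sub>F n in sequentially. - 1 + real n / real (K n) * (t n (j + 1) - t n j)
      \<le> real (m n (Suc j) - m n j) / real (K n)"
    proof (rule always_eventually, rule allI)
      fix n
      have K1: "real (K n) \<ge> 1" using K_pos[of n] by simp
      have "real n * t n (Suc j) - real n * t n j - real (K n) \<le> real (m n (Suc j) - m n j)"
        using nat_floor_diff_ge[of "real n * t n (Suc j)" "real n * t n j"] t_nonneg j K1
        by (simp add: m_def)
      then have "(real n * t n (Suc j) - real n * t n j - real (K n)) / real (K n)
          \<le> real (m n (Suc j) - m n j) / real (K n)"
        by (rule divide_right_mono) simp
      then show "- 1 + real n / real (K n) * (t n (j + 1) - t n j) \<le> real (m n (Suc j) - m n j) / real (K n)"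
        using K1 by (simp add: diff_divide_distrib right_diff_distrib)
    qed
  qed
  show ?thesis
  \<comment> \<open>The constant 1 is the exact second moment of every normalized coordinate and of
    every normal variable.\<close>
  proof (rule conv_in_distribution_if_char_tendsto[where C = 1])
    fix n j assume j: "j \<in> {1..s}"
    interpret hypercube_walk "M (K n)" "K n" "Y (K n)" by (rule walk)
    let ?X = "\<lambda>\<omega>. (\<lambda>j\<in>{1..s}. 1 / sqrt (real (K n)) * scaled_walk Y n (K n) (t n j) \<omega>) j"
    have eq: "(?X \<omega>)\<^sup>2 = (coord_sum (K n) (Y (K n) (m n j) \<omega>))\<^sup>2 / real (K n)" for \<omega>
      using j by (simp add: walk_eq power_divide)
    show "integrable (M (K n)) (\<lambda>\<omega>. (?X \<omega>)\<^sup>2)"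
      unfolding eq by (rule integrable_Y)
    show "(\<integral>\<omega>. (?X \<omega>)\<^sup>2 \<partial>M (K n)) \<le> 1"
      unfolding eq using K_pos[of n] by (simp add: expectation_coord_sum_sq)
  next
    fix n
    interpret hypercube_walk "M (K n)" "K n" "Y (K n)" by (rule walk)
    show "(\<lambda>\<omega>. \<lambda>j\<in>{1..s}. 1 / sqrt (real (K n)) * scaled_walk Y n (K n) (t n j) \<omega>)
      \<in> M (K n) \<rightarrow>\<^sub>M (\<Pi>\<^sub>M j\<in>{1..s}. borel)"
      unfolding walk_eq by (rule measurable_restrict) (rule Y_comp_measurable)
  next
    have "G j \<in> borel_measurable N" if "j \<in> {1..s}" for j
      using distributed_measurable[OF G_normal[OF that]] by simp
    then show "(\<lambda>\<omega>. \<lambda>j\<in>{1..s}. G j \<omega>) \<in> N \<rightarrow>\<^sub>M (\<Pi>\<^sub>M j\<in>{1..s}. borel)"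
      by (rule measurable_restrict)
  next
    fix j assume "j \<in> {1..s}"
    then show "integrable N (\<lambda>\<omega>. ((\<lambda>j\<in>{1..s}. G j \<omega>) j)\<^sup>2)"
      and "(\<integral>\<omega>. ((\<lambda>j\<in>{1..s}. G j \<omega>) j)\<^sup>2 \<partial>N) \<le> 1"
      using N.std_normal_second_moment[OF G_normal] by simp_all
  next
    fix \<theta> :: "nat \<Rightarrow> real"
    have "(\<integral>\<omega>. iexp (\<Sum>j=1..s. \<theta> j * (\<lambda>j\<in>{1..s}. G j \<omega>) j) \<partial>N) =
      complex_of_real (\<Prod>j=1..s. exp (- (\<theta> j)\<^sup>2 / 2))"
      using N.char_indep_std_normal[OF _ G_indep G_normal, where \<theta> = \<theta>] by simp
    moreover have "iexp (\<Sum>j=1..s. \<theta> j *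
        (\<lambda>j\<in>{1..s}. 1 / sqrt (real (K n)) * scaled_walk Y n (K n) (t n j) \<omega>) j) =
      (\<Prod>j=1..s. iexp (\<theta> j / sqrt (real (K n)) * coord_sum (K n) (Y (K n) (m n j) \<omega>)))" for n \<omega>
      by (simp add: walk_eq sum_distrib_left exp_sum)
    ultimately show "(\<lambda>n. \<integral>\<omega>. iexp (\<Sum>j=1..s. \<theta> j *
        (\<lambda>j\<in>{1..s}. 1 / sqrt (real (K n)) * scaled_walk Y n (K n) (t n j) \<omega>) j) \<partial>M (K n))
      \<longlonglongrightarrow> (\<integral>\<omega>. iexp (\<Sum>j=1..s. \<theta> j * (\<lambda>j\<in>{1..s}. G j \<omega>) j) \<partial>N)"
      using walk_char_tendsto[where M = "\<lambda>n. M (K n)" and Y = "\<lambda>n. Y (K n)" and m = m and \<theta> = \<theta>,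
        OF walk K_lim mono gap order_refl] by simp
  qed (fact P N_prob)+
qed

end
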